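(* Let $(X,X')$ be an exchangeable pair of random variables with values in a measurable space $\mathscr X$, let $\varphi:\mathscr X\to\mathbb R$ be measurable, and put $W=\varphi(X)$, $W'=\varphi(X')$, $\Delta=W-W'$. Assume that there is an antisymmetric function $\Psi:\mathscr X\times\mathscr X\to\mathbb R$ such that $D:=\Psi(X,X')$ satisfies $\mathbb E\{D\mid X\}=\lambda(W+R)$ for some constant $\lambda>0$ and some random variable $R=r(X)$. Let $D^*:=D^*(X,X')$ be any random variable such that $D^*(X,X')=D^*(X',X)$ and $D^*\ge |D|$. Assume that there exist a constant $\tau>0$ and increasing (i.e. nondecreasing) functions $\delta_1,\delta_2,\delta_3$ on $[0,\tau]$ with $\delta_j(\tau)<\infty$ for $j=1,2,3$, such that for all $0\le t\le\tau$: (i) $\mathbb E\{(1+|D|)e^{tW}\}<\infty$; (ii) $\mathbb E\bigl\{\bigl|1-\frac{1}{2\lambda}\mathbb E\{D\Delta\mid X\}\bigr|e^{tW}\bigr\}\le \delta_1(t)\,\mathbb E e^{tW}$; (iii) $\mathbb E\bigl\{\bigl|\frac{1}{2\lambda}\mathbb E\{D^*\Delta\mid X\}\bigr|e^{tW}\bigr\}\le \delta_2(t)\,\mathbb E e^{tW}$; (iv) $\mathbb E\{|R|e^{tW}\}\le\delta_3(t)\,\mathbb E e^{tW}$. For $\theta>0$ let $$\tau_0(\theta):=\max\Bigl\{0\le t\le\tau:\ \tfrac{t^2}{2}\bigl(\delta_1(t)+\delta_2(t)\bigr)+t\,\delta_3(t)\le\theta\Bigr\}.$$ Then, for any $\theta>0$,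 $$\left|\frac{\mathbb P(W>z)}{1-\Phi(z)}-1\right|\le 20\,e^{\theta}\Bigl((1+z^2)\bigl(\delta_1(z)+\delta_2(z)\bigr)+(1+z)\,\delta_3(z)\Bigr)$$ provided that $0\le z\le\tau_0(\theta)$.
   Context: $\Phi$ is the standard normal distribution function. A pair $(X,X')$ is exchangeable if $(X,X')$ and $(X',X)$ have the same distribution. A function $\Psi$ is antisymmetric if $\Psi(x,x')=-\Psi(x',x)$. All functions are measurable, and the random variables $D$, $D\Delta$, $D^*\Delta$ whose conditional expectations appear are understood to be integrable. *)

theory Defs
  imports "HOL-Probability.Probability"
begin

definition exchangeable_pair ::
  "'a measure \<Rightarrow> 'b measure \<Rightarrow> ('a \<Rightarrow> 'b) \<Rightarrow> ('a \<Rightarrow> 'b) \<Rightarrow> bool" where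
  "exchangeable_pair M S X X' \<longleftrightarrow>
     X \<in> measurable M S \<and> X' \<in> measurable M S \<and>
     distr M (S \<Otimes>\<^sub>M S) (\<lambda>\<omega>. (X \<omega>, X' \<omega>)) = distr M (S \<Otimes>\<^sub>M S) (\<lambda>\<omega>. (X' \<omega>, X \<omega>))"

(* The algebra being conditioned on is the sigma-algebra on space M generated by X.
   As for any conditional expectation, the value is only meaningful almost everywhere
   and for integrable Y. *)
definition cond_exp_given ::
  "'a measure \<Rightarrow> 'b measure \<Rightarrow> ('a \<Rightarrow> 'b) \<Rightarrow> ('a \<Rightarrow> real) \<Rightarrow> 'a \<Rightarrow> real" where
  "cond_exp_given M S X Y = real_cond_exp M (vimage_algebra (space M) X S) Y"

definition Phi :: "real \<Rightarrow> real" where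
  "Phi = cdf std_normal_distribution"

(* The supremum is the maximum whenever the maximum exists. Monotone functions may jump, in
   which case the supremum of the set need not belong to it; the supremum is then the
   reading of "max" under which the threshold is still defined. For theta > 0 and tau > 0
   the set contains 0 and is bounded by tau. *)
definition tau0 ::
  "real \<Rightarrow> (real \<Rightarrow> real) \<Rightarrow> (real \<Rightarrow> real) \<Rightarrow> (real \<Rightarrow> real) \<Rightarrow> real \<Rightarrow> real" where
  "tau0 \<tau> \<delta>1 \<delta>2 \<delta>3 \<theta> =
     Sup {t. 0 \<le> t \<and> t \<le> \<tau> \<and> t\<^sup>2 / 2 * (\<delta>1 t + \<delta>2 t) + t * \<delta>3 t \<le> \<theta>}"

(* E f \<le> c for a real bound c, finiteness of E f included: the Bochner integral of a
   non-integrable function is 0, so the inequality alone would not say this. *)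
definition expectation_le :: "'a measure \<Rightarrow> ('a \<Rightarrow> real) \<Rightarrow> real \<Rightarrow> bool" where
  "expectation_le M f c \<longleftrightarrow> integrable M f \<and> integral\<^sup>L M f \<le> c"

end

theory Submission
  imports Defs "HOL-Real_Asymp.Real_Asymp"
begin

text \<open>
  The proof combines Stein's method with an exponential change of measure.

  Let \<open>f = stein_sol z\<close> solve \<open>f' w - w f w = 1{w \<le> z} - Phi z\<close>. Then
  \<open>P(W > z) - (1 - Phi z) = E(W f(W) - f'(W))\<close>. Antisymmetry of \<open>\<Psi>\<close> and the linear
  regression \<open>E(D | X) = lam (W + R)\<close> turn \<open>2 lam E((W + R) f(W))\<close> into
  \<open>E(D (f(W) - f(W')))\<close>. Replacing the increment of \<open>f\<close> by the trapezoidal rule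
  \<open>\<Delta> (f'(W) + f'(W')) / 2\<close> gives \<open>E(D \<Delta> f'(W))\<close>, because \<open>D \<Delta>\<close> is a symmetric
  function of the pair. The error of that rule is controlled without any smoothness: if
  \<open>f' = g1 - g2\<close> with \<open>g1\<close>, \<open>g2\<close> nondecreasing, it is at most half the increment of
  \<open>g1 + g2\<close> times \<open>\<Delta>\<close>, and since \<open>Dstar \<Delta>\<close> is antisymmetric, the expectation of this
  bound multiplied by \<open>Dstar\<close> is \<open>E(Dstar \<Delta> (g1 + g2)(W))\<close>. This is
  \<open>stein_identity\<close>; \<open>stein_discrepancy\<close> sorts the result into the three quantities that the
  conditions of the theorem control. For the solution \<open>f\<close> the two nondecreasing parts are
  \<open>g1 w = w f w + (1 - Phi z)\<close> and \<open>g2 w = 1{w > z}\<close>. That \<open>g1\<close> is nondecreasing is a fact about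
  the Mills ratio.

  It remains to bound \<open>E(Y f(W))\<close> and \<open>E(Y (g1 + g2)(W))\<close> when only \<open>E(Y exp(t W))\<close> is known, and
  to gain the factor \<open>1 - Phi z\<close>. On \<open>(0, z]\<close> the functions grow like \<open>exp(w\<^sup>2 / 2)\<close>; the
  tangent lines \<open>t w - t\<^sup>2 / 2\<close>, for \<open>t\<close> on a grid of mesh at most one in \<open>(0, z]\<close>, stay
  within \<open>1/2\<close> of \<open>w\<^sup>2 / 2\<close>, so these functions are dominated by a finite sum of exponentials
  \<open>exp(t w - t\<^sup>2 / 2)\<close>. Beyond \<open>z\<close> boundedness and \<open>exp(z w - z\<^sup>2) \<ge> 1\<close> suffice, as
  \<open>exp(- z\<^sup>2 / 2)\<close> is at most \<open>3 (1 + z) (1 - Phi z)\<close>.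

  What is then needed is \<open>E exp(t W) \<le> exp(\<theta> + t\<^sup>2 / 2)\<close> for \<open>0 \<le> t \<le> z\<close>. The
  discrepancy bound, applied to the truncated functions \<open>exp(t min(w, n))\<close>, shows that
  \<open>E(W exp(t W))\<close> differs from \<open>t E exp(t W)\<close> by at most
  \<open>(t (\<delta>1 t + \<delta>2 t) + \<delta>3 t) E exp(t W)\<close> (\<open>tilted_mean\<close>). A Gronwall argument
  integrates this, and the definition of \<open>tau0\<close> bounds the accumulated error by \<open>\<theta>\<close>.
\<close>

section \<open>The normal distribution function\<close>

lemma Phi_diff:
  assumes "x \<le> y"
  shows "Phi y - Phi x = integral {x..y} std_normal_density"
proof -
  interpret real_distribution std_normal_distribution by (rule real_dist_normal_dist)
  have "Phi y - Phi x = measure std_normal_distribution {x<..y}"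
    using assms unfolding Phi_def by (cases "x = y") (auto simp: cdf_diff_eq)
  also have "\<dots> = integral\<^sup>L std_normal_distribution (indicator {x<..y})"
    by simp
  also have "\<dots> = (\<integral>w. indicator {x<..y} w * std_normal_density w \<partial>lborel)"
    by (subst integral_density) (auto simp: mult.commute)
  also have "\<dots> = (\<integral>w. indicator {x..y} w * std_normal_density w \<partial>lborel)"
  proof (rule integral_cong_AE)
    have "AE w in lborel. w \<noteq> x" by (rule AE_lborel_singleton)
    thus "AE w in lborel. indicator {x<..y} w * std_normal_density w
            = indicator {x..y} w * std_normal_density w"
      by eventually_elim (auto simp: indicator_def)
  qed auto
  also have "\<dots> = set_lebesgue_integral lborel {x..y} std_normal_density"
    by (simp add: set_lebesgue_integral_def)
  also have "\<dots> = integral {x..y} std_normal_density"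
  proof (rule set_borel_integral_eq_integral)
    show "set_integrable lborel {x..y} std_normal_density"
      unfolding std_normal_density_def
      by (intro borel_integrable_atLeastAtMost' continuous_intros) auto
  qed
  finally show ?thesis .
qed

lemma Phi_has_derivative [derivative_intros]:
  "(Phi has_real_derivative std_normal_density x) (at x)"
proof -
  have cont: "continuous_on {x-1..x+1} std_normal_density"
    unfolding std_normal_density_def by (intro continuous_intros) auto
  have "((\<lambda>u. integral {x-1..u} std_normal_density) has_real_derivative std_normal_density x)
          (at x within {x-1..x+1})"
    by (rule integral_has_real_derivative[OF cont]) auto
  hence "((\<lambda>u. Phi (x-1) + integral {x-1..u} std_normal_density) has_real_derivative
           std_normal_density x) (at x within {x-1..x+1})"
    by (auto intro!: derivative_eq_intros)
  hence "(Phi has_real_derivative std_normal_density x) (at x within {x-1..x+1})"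
    by (rule has_field_derivative_transform_within[where d = 1]) (auto simp: Phi_diff[symmetric])
  thus ?thesis
    by (simp add: at_within_Icc_at)
qed

lemma Phi_has_derivative' [derivative_intros]:
  "(f has_real_derivative f') (at x within A) \<Longrightarrow>
   ((\<lambda>x. Phi (f x)) has_real_derivative std_normal_density (f x) * f') (at x within A)"
  using DERIV_chain2[OF Phi_has_derivative] by blast

lemma Phi_at_top: "(Phi \<longlongrightarrow> 1) at_top" and Phi_at_bot: "(Phi \<longlongrightarrow> 0) at_bot"
  and Phi_le_1: "Phi x \<le> 1" and Phi_nonneg: "0 \<le> Phi x"
proof -
  interpret real_distribution std_normal_distribution by (rule real_dist_normal_dist)
  show "(Phi \<longlongrightarrow> 1) at_top" unfolding Phi_def by (rule cdf_lim_at_top_prob)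
  show "(Phi \<longlongrightarrow> 0) at_bot" unfolding Phi_def by (rule cdf_lim_at_bot)
  show "Phi x \<le> 1" unfolding Phi_def by (rule cdf_bounded_prob)
  show "0 \<le> Phi x" unfolding Phi_def by (rule cdf_nonneg)
qed

lemma std_normal_density_minus: "std_normal_density (-x) = std_normal_density x"
  by (simp add: std_normal_density_def)

lemma std_normal_density_has_derivative:
  "(std_normal_density has_real_derivative - x * std_normal_density x) (at x)"
  unfolding std_normal_density_def by (auto intro!: derivative_eq_intros simp: field_simps)

lemma std_normal_density_has_derivative' [derivative_intros]:
  "(f has_real_derivative f') (at x within A) \<Longrightarrow>
   ((\<lambda>x. std_normal_density (f x)) has_real_derivative - f x * std_normal_density (f x) * f') (at x within A)"
  using DERIV_chain2[OF std_normal_density_has_derivative] by blast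

lemma std_normal_density_pos: "0 < std_normal_density x"
  by (simp add: std_normal_density_def)

text \<open>
  The sum \<open>Phi x + Phi (- x)\<close> has derivative zero, and its constant value is read off at infinity.
\<close>
lemma Phi_minus: "Phi (-x) = 1 - Phi x"
proof -
  have "\<exists>c. \<forall>x. Phi x + Phi (-x) = c"
    by (rule exI[of _ "Phi 0 + Phi (-0)"], intro allI, rule DERIV_isconst_all)
       (auto intro!: derivative_eq_intros simp: std_normal_density_minus)
  then obtain c where c: "\<And>x. Phi x + Phi (-x) = c" by blast
  have "((\<lambda>x. Phi x + Phi (-x)) \<longlongrightarrow> 1 + 0) at_top"
    by (intro tendsto_add Phi_at_top filterlim_compose[OF Phi_at_bot] filterlim_uminus_at_bot_at_top)
  hence "c = 1"
    unfolding c by (simp add: tendsto_const_iff)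
  thus ?thesis using c[of x] by simp
qed

lemma measurable_Phi [measurable]: "Phi \<in> borel_measurable borel"
  by (intro borel_measurable_continuous_onI continuous_at_imp_continuous_on ballI
        DERIV_isCont[OF Phi_has_derivative])

section \<open>The Mills ratio\<close>

text \<open>
  The reflected ratio \<open>Phi w / std_normal_density w\<close>, the other ingredient of Stein solutions, is
  \<open>mills_ratio (- w)\<close>, so one function serves both tails.
\<close>
definition mills_ratio :: "real \<Rightarrow> real" where
  "mills_ratio x = (1 - Phi x) / std_normal_density x"

lemma mills_has_derivative:
  "(mills_ratio has_real_derivative x * mills_ratio x - 1) (at x)"
  unfolding mills_ratio_def using std_normal_density_pos[of x]
  by (auto intro!: derivative_eq_intros simp: field_simps)

text \<open>
  The device behind all the tail estimates: to compare \<open>1 - Phi\<close> with an explicit multiple of the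
  density, it is enough to compare derivatives, because both vanish at infinity.
\<close>
lemma nonneg_of_decreasing_to_0:
  fixes u :: "real \<Rightarrow> real"
  assumes "\<And>y. y \<ge> x \<Longrightarrow> (u has_real_derivative u' y) (at y)"
    and "\<And>y. y \<ge> x \<Longrightarrow> u' y \<le> 0"
    and lim: "(u \<longlongrightarrow> 0) at_top"
  shows "0 \<le> u x"
proof (rule tendsto_upperbound[OF lim])
  show "\<forall>\<^sub>F y in at_top. u y \<le> u x"
    using eventually_ge_at_top[of x]
    by eventually_elim (rule DERIV_nonpos_imp_nonincreasing, use assms in auto)
qed simp

lemma std_normal_density_at_top: "(std_normal_density \<longlongrightarrow> 0) at_top"
  unfolding std_normal_density_def by real_asymp

text \<open>
  Sharp enough at infinity to make \<open>x * mills_ratio x\<close> nondecreasing.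
\<close>
lemma mills_ge_rational:
  assumes "0 \<le> x"
  shows "x / (1 + x\<^sup>2) \<le> mills_ratio x"
proof -
  define u where "u x = (1 - Phi x) - std_normal_density x * (x / (1 + x\<^sup>2))" for x :: real
  have nz: "1 + y\<^sup>2 \<noteq> 0" for y :: real by (smt (verit) zero_le_power2)
  have "0 \<le> u x"
  proof (rule nonneg_of_decreasing_to_0[where u = u and u' = "\<lambda>y. - 2 / (1 + y\<^sup>2)\<^sup>2 * std_normal_density y"])
    fix y
    show "(u has_real_derivative - 2 / (1 + y\<^sup>2)\<^sup>2 * std_normal_density y) (at y)"
      unfolding u_def using nz[of y]
      by (auto intro!: derivative_eq_intros)
         (simp add: divide_simps, simp add: algebra_simps power2_eq_square power4_eq_xxxx)
    show "- 2 / (1 + y\<^sup>2)\<^sup>2 * std_normal_density y \<le> 0" by (simp add: mult_nonneg_nonneg)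
  next
    have "((\<lambda>x. (1 - Phi x) - std_normal_density x * (x / (1 + x\<^sup>2))) \<longlongrightarrow> (1 - 1) - 0 * 0) at_top"
      by (intro tendsto_diff tendsto_mult tendsto_const Phi_at_top std_normal_density_at_top) real_asymp
    thus "(u \<longlongrightarrow> 0) at_top" unfolding u_def by simp
  qed
  thus ?thesis unfolding u_def mills_ratio_def using std_normal_density_pos[of x]
    by (simp add: field_simps)
qed

text \<open>
  Weaker at infinity than the preceding bound, but not degenerate at zero, so that it yields
  a lower bound for \<open>1 - Phi z\<close> uniformly in \<open>z \<ge> 0\<close>.
\<close>
lemma mills_ge_inverse:
  assumes "0 \<le> x"
  shows "1 / (1 + x) \<le> mills_ratio x"
proof -
  define u where "u x = (1 - Phi x) - std_normal_density x * (1 / (1 + x))" for x :: real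
  have "0 \<le> u x"
  proof (rule nonneg_of_decreasing_to_0[where u = u and u' = "\<lambda>y. - y / (1 + y)\<^sup>2 * std_normal_density y"])
    fix y assume "x \<le> y"
    hence y: "0 \<le> y" using assms by simp
    show "(u has_real_derivative - y / (1 + y)\<^sup>2 * std_normal_density y) (at y)"
      unfolding u_def using y
      by (auto intro!: derivative_eq_intros)
         (simp add: divide_simps, simp add: algebra_simps power2_eq_square)
    show "- y / (1 + y)\<^sup>2 * std_normal_density y \<le> 0" using y by (simp add: mult_nonneg_nonneg)
  next
    have "((\<lambda>x. (1 - Phi x) - std_normal_density x * (1 / (1 + x))) \<longlongrightarrow> (1 - 1) - 0 * 0) at_top"
      by (intro tendsto_diff tendsto_mult tendsto_const Phi_at_top std_normal_density_at_top) real_asymp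
    thus "(u \<longlongrightarrow> 0) at_top" unfolding u_def by simp
  qed
  thus ?thesis unfolding u_def mills_ratio_def using std_normal_density_pos[of x] assms
    by (simp add: field_simps)
qed

lemma mills_nonneg: "0 \<le> mills_ratio x"
  unfolding mills_ratio_def using Phi_le_1[of x] by simp

lemma mult_mills_le_1: "x * mills_ratio x \<le> 1"
proof (cases "0 < x")
  case True
  define u where "u x = std_normal_density x * (1 / x) - (1 - Phi x)" for x :: real
  have "0 \<le> u x"
  proof (rule nonneg_of_decreasing_to_0[where u = u and u' = "\<lambda>y. - 1 / y\<^sup>2 * std_normal_density y"])
    fix y assume "x \<le> y"
    hence y: "0 < y" using True by simp
    show "(u has_real_derivative - 1 / y\<^sup>2 * std_normal_density y) (at y)"
      unfolding u_def using y
      by (auto intro!: derivative_eq_intros) (simp add: divide_simps power2_eq_square)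
    show "- 1 / y\<^sup>2 * std_normal_density y \<le> 0" by (simp add: mult_nonneg_nonneg)
  next
    have "((\<lambda>x. std_normal_density x * (1 / x) - (1 - Phi x)) \<longlongrightarrow> 0 * 0 - (1 - 1)) at_top"
      by (intro tendsto_diff tendsto_mult tendsto_const Phi_at_top std_normal_density_at_top) real_asymp
    thus "(u \<longlongrightarrow> 0) at_top" unfolding u_def by simp
  qed
  thus ?thesis unfolding u_def mills_ratio_def using std_normal_density_pos[of x] True
    by (simp add: field_simps)
next
  case False
  thus ?thesis using mult_nonneg_nonneg[of "-x" "mills_ratio x"] mills_nonneg[of x] by simp
qed

lemma mills_antimono: "x \<le> y \<Longrightarrow> mills_ratio y \<le> mills_ratio x"
  by (rule DERIV_nonpos_imp_nonincreasing)
     (use mills_has_derivative mult_mills_le_1 in \<open>auto intro!: exI\<close>)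

text \<open>
  The derivative is \<open>(1 + x\<^sup>2) * mills_ratio x - x\<close>, whose sign is the rational lower bound.
\<close>
lemma mono_mult_mills: "x \<le> y \<Longrightarrow> x * mills_ratio x \<le> y * mills_ratio y"
proof (erule DERIV_nonneg_imp_nondecreasing)
  fix x :: real
  have "((\<lambda>x. x * mills_ratio x) has_real_derivative (1 + x\<^sup>2) * mills_ratio x - x) (at x)"
    by (auto intro!: derivative_eq_intros mills_has_derivative simp: algebra_simps power2_eq_square)
  moreover have "0 \<le> (1 + x\<^sup>2) * mills_ratio x - x"
  proof (cases "0 \<le> x")
    case True
    have "0 < 1 + x\<^sup>2" by (smt (verit) zero_le_power2)
    thus ?thesis using mills_ge_rational[OF True] by (simp add: field_simps)
  next
    case False
    have "0 \<le> (1 + x\<^sup>2) * mills_ratio x" using mills_nonneg by simp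
    thus ?thesis using False by simp
  qed
  ultimately show "\<exists>d. ((\<lambda>x. x * mills_ratio x) has_real_derivative d) (at x) \<and> 0 \<le> d" by blast
qed

text \<open>
  The derivative \<open>x * mills_ratio x - 1\<close> is nondecreasing, so the Mills ratio is convex.
\<close>
lemma mills_above_tangent: "(x * mills_ratio x - 1) * (y - x) \<le> mills_ratio y - mills_ratio x"
proof -
  have "convex_on UNIV mills_ratio"
    by (rule convex_on_realI[where f' = "\<lambda>x. x * mills_ratio x - 1"])
       (auto intro: mills_has_derivative mono_mult_mills)
  hence "(x * mills_ratio x - 1) * (y - x) \<le> mills_ratio y - mills_ratio x"
    by (rule convex_on_imp_above_tangent) (auto intro: mills_has_derivative)
  thus ?thesis .
qed

lemma sqrt_2pi_le_3: "sqrt (2 * pi) \<le> 3"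
  using pi_less_4 by (intro real_le_lsqrt) auto

lemma mills_le_exp: "mills_ratio x \<le> 3 * exp (x\<^sup>2 / 2)"
proof -
  have "mills_ratio x = (1 - Phi x) * sqrt (2 * pi) * exp (x\<^sup>2 / 2)"
    unfolding mills_ratio_def std_normal_density_def by (simp add: field_simps exp_minus)
  also have "\<dots> \<le> 1 * 3 * exp (x\<^sup>2 / 2)"
    using Phi_nonneg[of x] sqrt_2pi_le_3 Phi_le_1[of x] by (intro mult_mono) auto
  finally show ?thesis by simp
qed

lemma exp_le_normal_tail:
  assumes "0 \<le> z"
  shows "exp (- z\<^sup>2 / 2) \<le> 3 * (1 + z) * (1 - Phi z)"
proof -
  have "exp (- z\<^sup>2 / 2) = sqrt (2 * pi) * std_normal_density z"
    by (simp add: std_normal_density_def field_simps)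
  also have "\<dots> \<le> 3 * ((1 + z) * (1 - Phi z))"
    using mills_ge_inverse[OF assms] sqrt_2pi_le_3 std_normal_density_pos[of z] assms
    by (intro mult_mono) (auto simp: mills_ratio_def field_simps)
  finally show ?thesis by (simp only: mult.assoc)
qed

lemma Phi_less_1: "Phi x < 1"
proof -
  have "0 < 3 * (1 + max 0 x) * (1 - Phi (max 0 x))"
    by (rule less_le_trans[OF _ exp_le_normal_tail]) auto
  hence "Phi (max 0 x) < 1" by (auto simp: zero_less_mult_iff)
  moreover have "Phi x \<le> Phi (max 0 x)"
    by (rule DERIV_nonneg_imp_nondecreasing[where f = Phi])
       (use Phi_has_derivative std_normal_density_pos in \<open>auto intro: less_imp_le\<close>)
  ultimately show ?thesis by simp
qed

lemma measurable_mills [measurable]: "mills_ratio \<in> borel_measurable borel"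
  unfolding mills_ratio_def[abs_def] by measurable

lemma mills_le_3: "0 \<le> x \<Longrightarrow> mills_ratio x \<le> 3"
  using mills_antimono[of 0 x] mills_le_exp[of 0] by simp

section \<open>Subgradients\<close>

text \<open>
  Stein functions are used only through their convex parts, and of a convex function only the
  supporting lines at all points are needed. This avoids integrals of almost-everywhere derivatives
  at the kinks.
\<close>
definition subgradient :: "(real \<Rightarrow> real) \<Rightarrow> (real \<Rightarrow> real) \<Rightarrow> bool" where
  "subgradient F g \<longleftrightarrow> (\<forall>x y. g x * (y - x) \<le> F y - F x)"

lemma subgradientD: "subgradient F g \<Longrightarrow> g x * (y - x) \<le> F y - F x"
  by (simp add: subgradient_def)

text \<open>
  The error of the trapezoidal rule for a convex function. Measuring from the midpoint
  \<open>(g x + g y) / 2\<close> rather than from \<open>g x\<close> halves the error bound, which is what lets the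
  coefficient of \<open>\<delta>2\<close> in the bound for the moment generating function be one.
\<close>
lemma subgradient_midpoint:
  assumes "subgradient F g"
  shows "\<bar>F x - F y - (x - y) * (g x + g y) / 2\<bar> \<le> (x - y) * (g x - g y) / 2"
  using subgradientD[OF assms, of x y] subgradientD[OF assms, of y x]
  by (simp add: abs_le_iff field_simps)

text \<open>
  For points on different sides of \<open>c\<close> the two inequalities are chained through \<open>c\<close>, where
  monotonicity of \<open>g\<close> compares the slopes.
\<close>
lemma subgradient_glue:
  assumes left: "\<And>x y. x \<le> c \<Longrightarrow> y \<le> c \<Longrightarrow> g x * (y - x) \<le> F y - F x"
    and right: "\<And>x y. c \<le> x \<Longrightarrow> c \<le> y \<Longrightarrow> g x * (y - x) \<le> F y - F x"
    and mono: "mono g"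
  shows "subgradient F g"
  unfolding subgradient_def
proof (intro allI)
  fix x y :: real
  consider "x \<le> c" "y \<le> c" | "c \<le> x" "c \<le> y" | "x \<le> c" "c \<le> y" | "c \<le> x" "y \<le> c"
    by linarith
  thus "g x * (y - x) \<le> F y - F x"
  proof cases
    case 3
    have "g x * (y - c) \<le> g c * (y - c)"
      using 3 monoD[OF mono, of x c] by (intro mult_right_mono) auto
    with 3 left[of x c] right[of c y] show ?thesis by (simp add: algebra_simps)
  next
    case 4
    have "g x * (y - c) \<le> g c * (y - c)"
      using 4 monoD[OF mono, of c x] by (intro mult_right_mono_neg) auto
    with 4 right[of x c] left[of c y] show ?thesis by (simp add: algebra_simps)
  qed (use left right in auto)
qed

lemma subgradient_hinge:
  "0 \<le> c \<Longrightarrow> subgradient (\<lambda>w. c * max (w - z) 0) (\<lambda>w. c * indicator {z<..} w)"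
  unfolding subgradient_def
  by (auto simp: indicator_def max_def right_diff_distrib[symmetric]
      intro!: mult_left_mono mult_nonneg_nonpos)

lemma exp_tangent: "t * exp (t * x) * (y - x) \<le> exp (t * y) - exp (t * x :: real)"
proof -
  have "exp (t * x) * (1 + t * (y - x)) \<le> exp (t * x) * exp (t * (y - x))"
    by (intro mult_left_mono exp_ge_add_one_self) auto
  also have "\<dots> = exp (t * y)" by (simp flip: exp_add add: algebra_simps)
  finally show ?thesis by (simp add: algebra_simps)
qed

text \<open>
  The bounded function \<open>exp (t * min w a)\<close> is not convex, but it becomes so once its graph is
  continued along the tangent at \<open>a\<close>. The continuation is a hinge, hence itself convex.
\<close>
lemma subgradient_capped_exp:
  assumes "0 \<le> t"
  shows "subgradient (\<lambda>w. exp (t * min w a) + t * exp (t * a) * max (w - a) 0) (\<lambda>w. t * exp (t * min w a))"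
proof (rule subgradient_glue[where c = a])
  show "mono (\<lambda>w. t * exp (t * min w a))"
    using assms by (intro monoI mult_left_mono) (auto intro!: mult_left_mono)
next
  fix x y assume "x \<le> a" "y \<le> a"
  thus "t * exp (t * min x a) * (y - x) \<le> exp (t * min y a) + t * exp (t * a) * max (y - a) 0
      - (exp (t * min x a) + t * exp (t * a) * max (x - a) 0)"
    using exp_tangent[of t x y] by simp
next
  fix x y assume "a \<le> x" "a \<le> y"
  thus "t * exp (t * min x a) * (y - x) \<le> exp (t * min y a) + t * exp (t * a) * max (y - a) 0
      - (exp (t * min x a) + t * exp (t * a) * max (x - a) 0)"
    by (simp add: right_diff_distrib)
qed

section \<open>The Stein solution of a half-line\<close>

text \<open>
  The bounded solution of \<open>f' w - w * f w = 1{w \<le> z} - Phi z\<close>.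
\<close>
definition stein_sol :: "real \<Rightarrow> real \<Rightarrow> real" where
  "stein_sol z w = (if w \<le> z then (1 - Phi z) * mills_ratio (- w) else Phi z * mills_ratio w)"

lemma measurable_stein_sol [measurable]: "stein_sol z \<in> borel_measurable borel"
  unfolding stein_sol_def[abs_def] by measurable

lemma stein_sol_at: "(1 - Phi z) * mills_ratio (- z) = Phi z * mills_ratio z"
  unfolding mills_ratio_def std_normal_density_minus Phi_minus by simp

lemma stein_sol_right: "z \<le> w \<Longrightarrow> stein_sol z w = Phi z * mills_ratio w"
  using stein_sol_at[of z] by (auto simp: stein_sol_def)

lemma stein_sol_nonneg: "0 \<le> stein_sol z w"
  unfolding stein_sol_def using Phi_le_1[of z] Phi_nonneg[of z] by (simp add: mills_nonneg)

text \<open>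
  The derivative of \<open>stein_sol z\<close> is \<open>stein_slope z w - 1{w > z}\<close>: moving the jump into a separate
  term leaves a continuous nondecreasing function.
\<close>
definition stein_slope :: "real \<Rightarrow> real \<Rightarrow> real" where
  "stein_slope z w = w * stein_sol z w + (1 - Phi z)"

lemma measurable_stein_slope [measurable]: "stein_slope z \<in> borel_measurable borel"
  unfolding stein_slope_def[abs_def] by measurable

lemma stein_slope_left:
  "w \<le> z \<Longrightarrow> stein_slope z w = (1 - Phi z) * (1 - (- w) * mills_ratio (- w))"
  by (simp add: stein_slope_def stein_sol_def algebra_simps)

lemma stein_slope_right:
  "z \<le> w \<Longrightarrow> stein_slope z w = 1 - Phi z * (1 - w * mills_ratio w)"
  by (simp add: stein_slope_def stein_sol_right algebra_simps)

text \<open>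
  On either side of \<open>z\<close> this is monotonicity of \<open>x * mills_ratio x\<close>.
\<close>
lemma mono_stein_slope: "mono (stein_slope z)"
proof (rule monoI)
  fix x y :: real assume "x \<le> y"
  have L: "stein_slope z x \<le> stein_slope z y" if "x \<le> y" "y \<le> z" for x y
    using that mono_mult_mills[of "-y" "-x"] Phi_le_1[of z]
    by (subst (1 2) stein_slope_left) (auto intro!: mult_left_mono)
  have R: "stein_slope z x \<le> stein_slope z y" if "x \<le> y" "z \<le> x" for x y
    using that mono_mult_mills[of x y] Phi_nonneg[of z]
    by (subst (1 2) stein_slope_right) (auto intro!: mult_left_mono)
  consider "y \<le> z" | "z \<le> x" | "x \<le> z" "z \<le> y" by linarith
  thus "stein_slope z x \<le> stein_slope z y"
    by cases (use L[of x y] R[of x y] L[of x z] R[of z y] \<open>x \<le> y\<close> in auto)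
qed

lemma stein_slope_le_1: "stein_slope z w \<le> 1"
proof -
  have "stein_slope z w \<le> stein_slope z (max w z)"
    by (intro monoD[OF mono_stein_slope]) simp
  also have "\<dots> \<le> 1"
    using mult_mills_le_1[of "max w z"] Phi_nonneg[of z] by (simp add: stein_slope_right)
  finally show ?thesis .
qed

lemma stein_slope_nonneg: "0 \<le> stein_slope z w"
proof -
  have "0 \<le> stein_slope z (min w z)"
    using mult_mills_le_1[of "- min w z"] Phi_le_1[of z]
    by (subst stein_slope_left) (auto simp del: minus_min_eq_max)
  also have "\<dots> \<le> stein_slope z w"
    by (intro monoD[OF mono_stein_slope]) simp
  finally show ?thesis .
qed

text \<open>
  Adding the hinge at \<open>z\<close> removes the downward jump of the derivative there.
\<close>
lemma subgradient_stein:
  "subgradient (\<lambda>w. stein_sol z w + max (w - z) 0) (stein_slope z)"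
proof (rule subgradient_glue[where c = z])
  fix x y :: real assume *: "x \<le> z" "y \<le> z"
  have "(1 - Phi z) * (((- x) * mills_ratio (- x) - 1) * ((- y) - (- x)))
          \<le> (1 - Phi z) * (mills_ratio (- y) - mills_ratio (- x))"
    using Phi_le_1[of z] by (intro mult_left_mono mills_above_tangent) auto
  thus "stein_slope z x * (y - x)
          \<le> stein_sol z y + max (y - z) 0 - (stein_sol z x + max (x - z) 0)"
    using * by (simp add: stein_slope_left stein_sol_def algebra_simps)
next
  fix x y :: real assume *: "z \<le> x" "z \<le> y"
  have "Phi z * ((x * mills_ratio x - 1) * (y - x)) \<le> Phi z * (mills_ratio y - mills_ratio x)"
    using Phi_nonneg[of z] by (intro mult_left_mono mills_above_tangent) auto
  thus "stein_slope z x * (y - x)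
          \<le> stein_sol z y + max (y - z) 0 - (stein_sol z x + max (x - z) 0)"
    using * by (simp add: stein_slope_right stein_sol_right algebra_simps)
qed (rule mono_stein_slope)

lemma stein_sol_le:
  assumes "0 \<le> z"
  shows "stein_sol z w \<le> 3 * exp (z\<^sup>2 / 2)"
proof (cases "0 \<le> w \<and> w \<le> z")
  case True
  have "stein_sol z w \<le> 1 * (3 * exp ((- w)\<^sup>2 / 2))"
    using True mills_le_exp[of "- w"] Phi_nonneg[of z] mills_nonneg[of "-w"]
    unfolding stein_sol_def by (simp only: True if_True) (intro mult_mono; simp)
  also have "\<dots> \<le> 3 * exp (z\<^sup>2 / 2)"
    using True by (auto intro: power_mono)
  finally show ?thesis .
next
  case False
  have "(1 - Phi z) * mills_ratio (- w) \<le> 1 * 3" if "w \<le> 0"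
    using that Phi_nonneg[of z] by (intro mult_mono mills_le_3 mills_nonneg) auto
  moreover have "Phi z * mills_ratio w \<le> 1 * 3" if "0 \<le> w"
    using that Phi_le_1[of z] by (intro mult_mono mills_le_3 mills_nonneg) auto
  ultimately have "stein_sol z w \<le> 1 * 3"
    using False assms by (auto simp: stein_sol_def)
  also have "\<dots> \<le> 3 * exp (z\<^sup>2 / 2)" by simp
  finally show ?thesis .
qed

section \<open>Gaussian growth dominated by exponential tilts\<close>

lemma exp_half_le_2: "exp (1 / 2 :: real) \<le> 2"
proof -
  have "exp (1 / 2 :: real) ^ 2 = exp 1"
    by (simp add: exp_of_nat_mult[symmetric])
  also have "\<dots> \<le> 2 ^ 2" using exp_le by simp
  finally show ?thesis by (rule power2_le_imp_le) simp
qed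

definition node_count :: "real \<Rightarrow> nat" where
  "node_count z = nat \<lceil>z\<rceil>"

text \<open>
  The multiples of \<open>z / node_count z\<close> cut \<open>(0, z]\<close> into cells of length at most one and end exactly at
  \<open>z\<close>; for \<open>z = 0\<close> there are none.
\<close>
definition node :: "real \<Rightarrow> nat \<Rightarrow> real" where
  "node z j = real j * z / real (node_count z)"

lemma node_bounds:
  assumes "0 \<le> z" "j \<in> {1..node_count z}"
  shows "0 \<le> node z j" "node z j \<le> z"
  using assms by (auto simp: node_def divide_simps mult_right_mono mult.commute[of z])

lemma node_count_le: "0 \<le> z \<Longrightarrow> real (node_count z) \<le> z + 1"
  unfolding node_count_def by linarith

text \<open>
  The sum equals \<open>z (n + 1) / 2\<close> with \<open>n \<le> z + 1\<close>, and \<open>z (z + 2) / 2 \<le> 1 + z\<^sup>2\<close>.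
\<close>
lemma sum_nodes_le:
  assumes "0 \<le> z"
  shows "(\<Sum>j=1..node_count z. node z j) \<le> 1 + z\<^sup>2"
proof (cases "z = 0")
  case False
  let ?n = "node_count z"
  have n: "0 < ?n" using False assms unfolding node_count_def by auto
  have "(\<Sum>j=1..?n. node z j) = (\<Sum>j=1..?n. real j) * (z / ?n)"
    by (simp add: node_def sum_distrib_right sum_divide_distrib)
  also have "(\<Sum>j=1..?n. real j) = real ?n * (real ?n + 1) / 2"
    using double_gauss_sum_from_Suc_0[of ?n, where 'a = real] by simp
  also have "real ?n * (real ?n + 1) / 2 * (z / ?n) = z * (real ?n + 1) / 2"
    using n by (simp add: field_simps)
  also have "\<dots> \<le> z * ((z + 1) + 1) / 2"
    using node_count_le[OF assms] assms by (intro divide_right_mono mult_left_mono) auto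
  also have "\<dots> \<le> 1 + z\<^sup>2"
    using zero_le_power2[of "z - 1"] by (simp add: power2_eq_square algebra_simps)
  finally show ?thesis .
qed (simp add: node_count_def)

text \<open>
  If \<open>t\<close> is the right end of the cell containing \<open>w\<close>, then
  \<open>w\<^sup>2 / 2 - (t w - t\<^sup>2 / 2) = (t - w)\<^sup>2 / 2 \<le> 1 / 2\<close>.
\<close>
lemma exp_square_le_tilt:
  assumes "0 < w" "w \<le> z"
  obtains j where "j \<in> {1..node_count z}" "w \<le> node z j"
     "exp (w\<^sup>2 / 2) \<le> 2 * exp (node z j * w - (node z j)\<^sup>2 / 2)"
proof -
  define n where "n = node_count z"
  have z: "0 < z" using assms by simp
  hence n: "0 < n" "z \<le> n" unfolding n_def node_count_def by linarith+
  define j where "j = nat \<lceil>w * n / z\<rceil>"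
  have wz: "0 < w * n / z" "w * n / z \<le> n" using assms z n by (auto simp: field_simps)
  have j1: "w * n / z \<le> j" "j \<le> w * n / z + 1" using wz unfolding j_def by linarith+
  have jn: "j \<in> {1..n}" using wz unfolding j_def by (auto simp: Suc_le_eq ceiling_le_iff nat_le_iff)
  define t where "t = node z j"
  have "w \<le> t" using j1(1) z n by (simp add: t_def node_def n_def[symmetric] field_simps)
  moreover have "t \<le> w + z / n" using j1(2) z n by (simp add: t_def node_def n_def[symmetric] field_simps)
  moreover have "z / n \<le> 1" using n by simp
  ultimately have "(t - w)\<^sup>2 \<le> 1" by (intro power_le_one) auto
  hence "w\<^sup>2 / 2 \<le> 1 / 2 + (t * w - t\<^sup>2 / 2)" by (simp add: power2_eq_square algebra_simps)
  hence "exp (w\<^sup>2 / 2) \<le> exp (1 / 2) * exp (t * w - t\<^sup>2 / 2)"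
    by (simp flip: exp_add)
  also have "\<dots> \<le> 2 * exp (t * w - t\<^sup>2 / 2)"
    using exp_half_le_2 by (intro mult_right_mono) auto
  finally show ?thesis using that[of j] jn \<open>w \<le> t\<close> unfolding t_def n_def by blast
qed

lemma exp_tilt_ge_1:
  assumes "0 \<le> z" "z < w" shows "(1::real) \<le> exp (z * w - z\<^sup>2)"
  using assms by (simp add: power2_eq_square mult_left_mono)

text \<open>
  The three terms dominate on \<open>w \<le> 0\<close>, on \<open>(0, z]\<close> and beyond \<open>z\<close> respectively. In the first two the
  factor \<open>1 - Phi z\<close> comes from the solution itself; in the third it is recovered after taking
  expectations.
\<close>
lemma stein_sol_le_tilts:
  assumes "0 \<le> z"
  shows "stein_sol z w \<le> 3 * (1 - Phi z)
    + 6 * (1 - Phi z) * (\<Sum>j=1..node_count z. exp (node z j * w - (node z j)\<^sup>2 / 2))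
    + 3 * exp (z * w - z\<^sup>2)" (is "_ \<le> ?A + ?B * ?S + ?C")
proof -
  have nn: "0 \<le> ?A" "0 \<le> ?B" "0 \<le> ?B * ?S" "0 \<le> ?C"
    using Phi_le_1[of z] by (auto intro!: mult_nonneg_nonneg sum_nonneg)
  consider "w \<le> 0" | "0 < w" "w \<le> z" | "z < w" by linarith
  thus ?thesis
  proof cases
    case 1
    hence "stein_sol z w = (1 - Phi z) * mills_ratio (- w)" using assms by (simp add: stein_sol_def)
    also have "\<dots> \<le> (1 - Phi z) * 3"
      using 1 Phi_le_1[of z] by (intro mult_left_mono mills_le_3) auto
    finally show ?thesis using nn by linarith
  next
    case 2
    then obtain j where j: "j \<in> {1..node_count z}"
      "exp (w\<^sup>2 / 2) \<le> 2 * exp (node z j * w - (node z j)\<^sup>2 / 2)"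
      by (rule exp_square_le_tilt)
    have "mills_ratio (- w) \<le> 3 * exp (w\<^sup>2 / 2)" using mills_le_exp[of "- w"] by simp
    also have "\<dots> \<le> 3 * (2 * exp (node z j * w - (node z j)\<^sup>2 / 2))"
      using j(2) by simp
    also have "exp (node z j * w - (node z j)\<^sup>2 / 2) \<le> ?S"
      using j(1) by (intro member_le_sum) auto
    finally have "(1 - Phi z) * mills_ratio (- w) \<le> (1 - Phi z) * (3 * (2 * ?S))"
      using Phi_le_1[of z] by (intro mult_left_mono) auto
    also have "\<dots> = ?B * ?S" by (simp only: mult_ac)
    also have "(1 - Phi z) * mills_ratio (- w) = stein_sol z w" using 2 by (simp only: stein_sol_def if_True)
    finally have "stein_sol z w \<le> ?B * ?S" .
    thus ?thesis using nn by linarith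
  next
    case 3
    have "Phi z * mills_ratio w \<le> 1 * 3"
      using 3 assms Phi_le_1[of z] by (intro mult_mono mills_le_3 mills_nonneg) auto
    hence "stein_sol z w \<le> 3" using 3 by (simp add: stein_sol_def)
    thus ?thesis using exp_tilt_ge_1[OF assms 3] nn by linarith
  qed
qed

text \<open>
  As for the solution. The extra factor \<open>w\<close> on \<open>(0, z]\<close> is bounded by the node to its right, and this
  is where \<open>1 + z\<^sup>2\<close> instead of \<open>1 + z\<close> enters the final bound.
\<close>
lemma stein_slope_le_tilts:
  assumes "0 \<le> z"
  shows "stein_slope z w + indicator {z<..} w \<le> (1 - Phi z)
    + 6 * (1 - Phi z) * (\<Sum>j=1..node_count z. node z j * exp (node z j * w - (node z j)\<^sup>2 / 2))
    + 2 * exp (z * w - z\<^sup>2)" (is "_ \<le> ?A + ?B * ?S + ?C")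
proof -
  have nn: "0 \<le> ?A" "0 \<le> ?B" "0 \<le> ?B * ?S" "0 \<le> ?C"
    using Phi_le_1[of z] node_bounds(1)[OF assms]
    by (auto intro!: mult_nonneg_nonneg sum_nonneg)
  consider "w \<le> 0" | "0 < w" "w \<le> z" | "z < w" by linarith
  thus ?thesis
  proof cases
    case 1
    hence "w * stein_sol z w \<le> 0" by (intro mult_nonpos_nonneg stein_sol_nonneg)
    moreover have "stein_slope z w + indicator {z<..} w = w * stein_sol z w + ?A"
      using 1 assms by (simp add: stein_slope_def)
    ultimately show ?thesis using nn by linarith
  next
    case 2
    then obtain j where j: "j \<in> {1..node_count z}" "w \<le> node z j"
      "exp (w\<^sup>2 / 2) \<le> 2 * exp (node z j * w - (node z j)\<^sup>2 / 2)"
      by (rule exp_square_le_tilt)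
    have "w * mills_ratio (- w) \<le> w * (3 * exp (w\<^sup>2 / 2))"
      using mills_le_exp[of "- w"] 2 by (intro mult_left_mono) auto
    also have "\<dots> \<le> node z j * (3 * (2 * exp (node z j * w - (node z j)\<^sup>2 / 2)))"
      using j 2 by (intro mult_mono) auto
    also have "\<dots> = 6 * (node z j * exp (node z j * w - (node z j)\<^sup>2 / 2))" by simp
    also have "node z j * exp (node z j * w - (node z j)\<^sup>2 / 2) \<le> ?S"
      using j(1) node_bounds(1)[OF assms] by (intro member_le_sum) auto
    finally have "(1 - Phi z) * (w * mills_ratio (- w)) \<le> (1 - Phi z) * (6 * ?S)"
      using Phi_le_1[of z] by (intro mult_left_mono) auto
    also have "\<dots> = ?B * ?S" by (simp only: mult_ac)
    also have "(1 - Phi z) * (w * mills_ratio (- w)) = w * stein_sol z w"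
      using 2 by (simp only: stein_sol_def if_True mult_ac)
    finally have "w * stein_sol z w \<le> ?B * ?S" .
    moreover have "stein_slope z w + indicator {z<..} w = w * stein_sol z w + ?A"
      using 2 by (simp add: stein_slope_def)
    ultimately show ?thesis using nn by linarith
  next
    case 3
    have "stein_slope z w + indicator {z<..} w \<le> 2" using stein_slope_le_1[of z w] 3 by simp
    thus ?thesis using exp_tilt_ge_1[OF assms 3] nn by linarith
  qed
qed

text \<open>
  A node \<open>t\<close> contributes \<open>exp (- t\<^sup>2 / 2) * E (Y exp (t W)) \<le> d\<close>: the Gaussian growth of
  the tilted expectations cancels. At \<open>z\<close> the weight is \<open>exp (- z\<^sup>2)\<close>, of which half is left over.
\<close>
lemma expectation_tilts_le:
  fixes M :: "'a measure" and W Y :: "'a \<Rightarrow> real" and c :: "nat \<Rightarrow> real"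
  assumes z: "0 \<le> z" and Y: "\<And>\<omega>. 0 \<le> Y \<omega>"
    and tilt: "\<And>t. 0 \<le> t \<Longrightarrow> t \<le> z \<Longrightarrow> expectation_le M (\<lambda>\<omega>. Y \<omega> * exp (t * W \<omega>)) (d * exp (t\<^sup>2 / 2))"
    and nonneg: "0 \<le> a" "0 \<le> b" "0 \<le> e" "\<And>j. j \<in> {1..node_count z} \<Longrightarrow> 0 \<le> c j"
    and G: "\<And>w. G w \<le> a + b * (\<Sum>j=1..node_count z. c j * exp (node z j * w - (node z j)\<^sup>2 / 2))
      + e * exp (z * w - z\<^sup>2)"
  shows "(\<integral>\<omega>. Y \<omega> * G (W \<omega>) \<partial>M) \<le> d * (a + b * (\<Sum>j=1..node_count z. c j) + e * exp (- z\<^sup>2 / 2))"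
proof -
  let ?J = "{1..node_count z}"
  define m where "m t = (\<integral>\<omega>. Y \<omega> * exp (t * W \<omega>) \<partial>M)" for t
  have I: "integrable M (\<lambda>\<omega>. Y \<omega> * exp (t * W \<omega>))" and m: "m t \<le> d * exp (t\<^sup>2 / 2)"
    if "0 \<le> t" "t \<le> z" for t using tilt[OF that] by (auto simp: expectation_le_def m_def)
  let ?H = "\<lambda>\<omega>. a * (Y \<omega> * exp (0 * W \<omega>))
      + b * (\<Sum>j\<in>?J. c j * exp (- ((node z j)\<^sup>2 / 2)) * (Y \<omega> * exp (node z j * W \<omega>)))
      + e * exp (- z\<^sup>2) * (Y \<omega> * exp (z * W \<omega>))"
  have H: "Y \<omega> * (a + b * (\<Sum>j\<in>?J. c j * exp (node z j * W \<omega> - (node z j)\<^sup>2 / 2))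
      + e * exp (z * W \<omega> - z\<^sup>2)) = ?H \<omega>" for \<omega>
  proof -
    have "exp (u - v) = exp (- v) * exp u" for u v :: real
      by (simp flip: exp_add)
    thus ?thesis by (simp add: distrib_left sum_distrib_left mult_ac)
  qed
  let ?f = "\<lambda>\<omega>. a * (Y \<omega> * exp (0 * W \<omega>))"
    and ?g = "\<lambda>j \<omega>. c j * exp (- ((node z j)\<^sup>2 / 2)) * (Y \<omega> * exp (node z j * W \<omega>))"
    and ?h = "\<lambda>\<omega>. e * exp (- z\<^sup>2) * (Y \<omega> * exp (z * W \<omega>))"
  have f: "integrable M ?f" and h: "integrable M ?h" by (intro integrable_mult_right I z order_refl)+
  have g: "integrable M (?g j)" if "j \<in> ?J" for j
    by (intro integrable_mult_right I node_bounds[OF z that])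
  have gs: "integrable M (\<lambda>\<omega>. b * (\<Sum>j\<in>?J. ?g j \<omega>))"
    by (intro integrable_mult_right Bochner_Integration.integrable_sum g)
  have HI: "integrable M ?H"
    by (rule Bochner_Integration.integrable_add[OF Bochner_Integration.integrable_add[OF f gs] h])
  have "(\<integral>\<omega>. Y \<omega> * G (W \<omega>) \<partial>M) \<le> (\<integral>\<omega>. ?H \<omega> \<partial>M)"
  proof (rule integral_mono'[OF HI])
    fix \<omega>
    show "Y \<omega> * G (W \<omega>) \<le> ?H \<omega>" unfolding H[symmetric] by (intro mult_left_mono G Y)
    show "0 \<le> ?H \<omega>" using nonneg Y by (intro add_nonneg_nonneg mult_nonneg_nonneg sum_nonneg) auto
  qed
  also have "(\<integral>\<omega>. ?H \<omega> \<partial>M) = a * m 0 + b * (\<Sum>j\<in>?J. c j * exp (- ((node z j)\<^sup>2 / 2)) * m (node z j))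
      + e * exp (- z\<^sup>2) * m z"
  proof -
    have "(\<integral>\<omega>. b * (\<Sum>j\<in>?J. ?g j \<omega>) \<partial>M) = b * (\<Sum>j\<in>?J. (\<integral>\<omega>. ?g j \<omega> \<partial>M))"
      by (subst integral_mult_right_zero, subst Bochner_Integration.integral_sum[OF g]) auto
    thus ?thesis
      unfolding m_def Bochner_Integration.integral_add[OF Bochner_Integration.integrable_add[OF f gs] h]
        Bochner_Integration.integral_add[OF f gs]
      by (simp only: integral_mult_right_zero)
  qed
  also have "\<dots> \<le> a * (d * exp (0\<^sup>2 / 2)) + b * (\<Sum>j\<in>?J. c j * exp (- ((node z j)\<^sup>2 / 2)) * (d * exp ((node z j)\<^sup>2 / 2)))
      + e * exp (- z\<^sup>2) * (d * exp (z\<^sup>2 / 2))"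
    using nonneg z node_bounds[OF z]
    by (intro add_mono mult_left_mono sum_mono m mult_nonneg_nonneg) auto
  also have "\<dots> = d * (a + b * (\<Sum>j\<in>?J. c j) + e * exp (- z\<^sup>2 / 2))"
  proof -
    have 1: "exp (- u) * (d * exp u) = d" for u :: real
      by (simp add: exp_minus)
    have 2: "exp (- z\<^sup>2) * (d * exp (z\<^sup>2 / 2)) = d * exp (- z\<^sup>2 / 2)"
    proof -
      have "exp (- z\<^sup>2) * exp (z\<^sup>2 / 2) = exp (- z\<^sup>2 / 2)" by (simp flip: exp_add)
      thus ?thesis by (metis mult.left_commute)
    qed
    have "a * (d * exp (0\<^sup>2 / 2)) = d * a" by simp
    moreover have "b * (\<Sum>j\<in>?J. c j * exp (- ((node z j)\<^sup>2 / 2)) * (d * exp ((node z j)\<^sup>2 / 2)))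
        = d * (b * (\<Sum>j\<in>?J. c j))"
      unfolding mult.assoc 1 by (simp only: sum_distrib_left[symmetric] mult_ac)
    moreover have "e * exp (- z\<^sup>2) * (d * exp (z\<^sup>2 / 2)) = d * (e * exp (- z\<^sup>2 / 2))"
      unfolding mult.assoc 2 by (rule mult.left_commute)
    ultimately show ?thesis by (simp only: distrib_left)
  qed
  finally show ?thesis .
qed

text \<open>
  The sum of the three constants is \<open>1 + 6 (1 + z\<^sup>2) + 6 (1 + z)\<close>, the last term coming from
  \<open>exp (- z\<^sup>2 / 2) \<le> 3 (1 + z) (1 - Phi z)\<close>.
\<close>
lemma expectation_stein_slope_le:
  fixes M :: "'a measure" and W Y :: "'a \<Rightarrow> real"
  assumes z: "0 \<le> z" and Y: "\<And>\<omega>. 0 \<le> Y \<omega>" and d: "0 \<le> d"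
    and tilt: "\<And>t. 0 \<le> t \<Longrightarrow> t \<le> z \<Longrightarrow> expectation_le M (\<lambda>\<omega>. Y \<omega> * exp (t * W \<omega>)) (d * exp (t\<^sup>2 / 2))"
  shows "(\<integral>\<omega>. Y \<omega> * (stein_slope z (W \<omega>) + 1 * indicator {z<..} (W \<omega>)) \<partial>M)
     \<le> 20 * (1 + z\<^sup>2) * d * (1 - Phi z)"
proof -
  let ?q = "1 - Phi z"
  have q: "0 < ?q" using Phi_less_1 by simp
  have "(\<integral>\<omega>. Y \<omega> * (stein_slope z (W \<omega>) + 1 * indicator {z<..} (W \<omega>)) \<partial>M)
     \<le> d * (?q + 6 * ?q * (\<Sum>j=1..node_count z. node z j) + 2 * exp (- z\<^sup>2 / 2))"
    using q stein_slope_le_tilts[OF z]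
    by (intro expectation_tilts_le[OF z Y tilt]) (auto simp: node_bounds(1)[OF z])
  also have "\<dots> \<le> d * (?q + 6 * ?q * (1 + z\<^sup>2) + 2 * (3 * (1 + z) * ?q))"
    using d q sum_nodes_le[OF z] exp_le_normal_tail[OF z] by (intro mult_left_mono add_mono) auto
  also have "\<dots> = (1 + 6 * (1 + z\<^sup>2) + 6 * (1 + z)) * (d * ?q)" by (simp add: algebra_simps)
  also have "\<dots> \<le> (20 * (1 + z\<^sup>2)) * (d * ?q)"
  proof (rule mult_right_mono)
    have "0 \<le> 3 * (z - 1)\<^sup>2 + 11 * z\<^sup>2 + 4" by simp
    also have "\<dots> = 20 * (1 + z\<^sup>2) - (1 + 6 * (1 + z\<^sup>2) + 6 * (1 + z))"
      by (simp add: power2_eq_square algebra_simps)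
    finally show "1 + 6 * (1 + z\<^sup>2) + 6 * (1 + z) \<le> 20 * (1 + z\<^sup>2)" by simp
  qed (use d q in simp)
  finally show ?thesis by (simp add: mult_ac)
qed

text \<open>
  The sum of the nodes is replaced by their number, which is at most \<open>1 + z\<close>.
\<close>
lemma expectation_stein_sol_le:
  fixes M :: "'a measure" and W Y :: "'a \<Rightarrow> real"
  assumes z: "0 \<le> z" and Y: "\<And>\<omega>. 0 \<le> Y \<omega>" and d: "0 \<le> d"
    and tilt: "\<And>t. 0 \<le> t \<Longrightarrow> t \<le> z \<Longrightarrow> expectation_le M (\<lambda>\<omega>. Y \<omega> * exp (t * W \<omega>)) (d * exp (t\<^sup>2 / 2))"
  shows "(\<integral>\<omega>. Y \<omega> * \<bar>stein_sol z (W \<omega>)\<bar> \<partial>M) \<le> 20 * (1 + z) * d * (1 - Phi z)"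
proof -
  let ?q = "1 - Phi z"
  have q: "0 < ?q" using Phi_less_1 by simp
  have "(\<integral>\<omega>. Y \<omega> * \<bar>stein_sol z (W \<omega>)\<bar> \<partial>M)
     \<le> d * (3 * ?q + 6 * ?q * (\<Sum>j=1..node_count z. 1) + 3 * exp (- z\<^sup>2 / 2))"
    using q stein_sol_le_tilts[OF z] stein_sol_nonneg[of z]
    by (intro expectation_tilts_le[OF z Y tilt]) auto
  also have "\<dots> \<le> d * (3 * ?q + 6 * ?q * (1 + z) + 3 * (3 * (1 + z) * ?q))"
    using d q node_count_le[OF z] exp_le_normal_tail[OF z] by (intro mult_left_mono add_mono) auto
  also have "\<dots> = (3 + 15 * (1 + z)) * (d * ?q)" by (simp add: algebra_simps)
  also have "\<dots> \<le> (20 * (1 + z)) * (d * ?q)"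
    using d q z by (intro mult_right_mono) auto
  finally show ?thesis by (simp add: mult_ac)
qed

section \<open>Stein identity for exchangeable pairs\<close>

lemma integrable_bounded_mult:
  fixes M :: "'a measure" and Y G :: "'a \<Rightarrow> real"
  assumes "integrable M Y" "G \<in> borel_measurable M" "\<And>\<omega>. \<bar>G \<omega>\<bar> \<le> C"
  shows "integrable M (\<lambda>\<omega>. Y \<omega> * G \<omega>)"
proof (rule Bochner_Integration.integrable_bound)
  show "integrable M (\<lambda>\<omega>. C * Y \<omega>)" using assms(1) by simp
  show "AE \<omega> in M. norm (Y \<omega> * G \<omega>) \<le> norm (C * Y \<omega>)"
    using order_trans[OF assms(3) abs_ge_self]
    by (auto intro!: AE_I2 mult_right_mono simp: abs_mult mult.commute[of "\<bar>Y _\<bar>"])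
qed (use assms in measurable)

text \<open>
  The exchangeable pair with its regression property.
\<close>
locale exchangeable_stein_pair = prob_space M for M :: "'a measure" +
  fixes S :: "'b measure"
    and X X' :: "'a \<Rightarrow> 'b"
    and \<phi> r :: "'b \<Rightarrow> real"
    and \<Psi> Dfun :: "'b \<times> 'b \<Rightarrow> real"
    and W W' \<Delta> D R Dstar :: "'a \<Rightarrow> real"
    and lam :: real
  assumes exchangeable: "exchangeable_pair M S X X'"
    and phi_measurable [measurable]: "\<phi> \<in> borel_measurable S"
    and W_eq: "W = (\<lambda>\<omega>. \<phi> (X \<omega>))"
    and W'_eq: "W' = (\<lambda>\<omega>. \<phi> (X' \<omega>))"
    and Delta_eq: "\<Delta> = (\<lambda>\<omega>. W \<omega> - W' \<omega>)"
    and Psi_measurable [measurable]: "\<Psi> \<in> borel_measurable (S \<Otimes>\<^sub>M S)"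
    and antisymmetric: "\<And>x x'. x \<in> space S \<Longrightarrow> x' \<in> space S \<Longrightarrow> \<Psi> (x, x') = - \<Psi> (x', x)"
    and D_eq: "D = (\<lambda>\<omega>. \<Psi> (X \<omega>, X' \<omega>))"
    and integrable_D: "integrable M D"
    and lam_pos: "lam > 0"
    and r_measurable [measurable]: "r \<in> borel_measurable S"
    and R_eq: "R = (\<lambda>\<omega>. r (X \<omega>))"
    and linearity: "AE \<omega> in M. cond_exp_given M S X D \<omega> = lam * (W \<omega> + R \<omega>)"
    and Dfun_measurable [measurable]: "Dfun \<in> borel_measurable (S \<Otimes>\<^sub>M S)"
    and Dstar_eq: "Dstar = (\<lambda>\<omega>. Dfun (X \<omega>, X' \<omega>))"
    and Dfun_symmetric: "AE \<omega> in M. Dfun (X \<omega>, X' \<omega>) = Dfun (X' \<omega>, X \<omega>)"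
    and Dstar_ge: "AE \<omega> in M. Dstar \<omega> \<ge> \<bar>D \<omega>\<bar>"
    and integrable_D_Delta: "integrable M (\<lambda>\<omega>. D \<omega> * \<Delta> \<omega>)"
    and integrable_Dstar_Delta: "integrable M (\<lambda>\<omega>. Dstar \<omega> * \<Delta> \<omega>)"
    and integrable_R: "integrable M R"
begin

text \<open>
  How far \<open>E(D \<Delta> | X) / (2 lam)\<close>, which plays the part of a conditional variance, is from the
  value \<open>1\<close> of the Gaussian case.
\<close>
definition variance_defect :: "'a \<Rightarrow> real" where
  "variance_defect \<omega> = 1 - 1 / (2 * lam) * cond_exp_given M S X (\<lambda>\<omega>. D \<omega> * \<Delta> \<omega>) \<omega>"

text \<open>
  Since \<open>Dstar * \<Delta>\<close> is antisymmetric, this has mean zero; it measures the remainder of the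
  trapezoidal rule.
\<close>
definition Dstar_drift :: "'a \<Rightarrow> real" where
  "Dstar_drift \<omega> = 1 / (2 * lam) * cond_exp_given M S X (\<lambda>\<omega>. Dstar \<omega> * \<Delta> \<omega>) \<omega>"

lemma X_measurable [measurable]: "X \<in> measurable M S" "X' \<in> measurable M S"
  using exchangeable by (auto simp: exchangeable_pair_def)

lemma W_measurable [measurable]: "W \<in> borel_measurable M"
  unfolding W_eq by measurable

abbreviation "sigma_X \<equiv> vimage_algebra (space M) X S"

lemma subalgebra_X: "subalgebra M sigma_X"
  unfolding subalgebra_def
  by (auto simp: sets_vimage_algebra2[OF measurable_space[OF X_measurable(1), THEN funcsetI]]
           intro: measurable_sets[OF X_measurable(1)])

sublocale finite_measure_subalgebra M sigma_X
  by unfold_locales (rule subalgebra_X)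

lemma W_sigma_X [measurable]: "W \<in> borel_measurable sigma_X"
  unfolding W_eq
  by (rule measurable_compose[OF measurable_vimage_algebra1 phi_measurable])
     (use measurable_space[OF X_measurable(1)] in auto)

lemma cond_exp_measurable [measurable]: "cond_exp_given M S X Y \<in> borel_measurable M"
  unfolding cond_exp_given_def by measurable

lemma defects_measurable [measurable]:
  "variance_defect \<in> borel_measurable M" "Dstar_drift \<in> borel_measurable M"
  unfolding variance_defect_def[abs_def] Dstar_drift_def[abs_def] by measurable

text \<open>
  The defining property of the conditional expectation, for bounded functions of \<open>W\<close>.
\<close>
lemma cond_exp_mult:
  assumes "integrable M Y" and G: "G \<in> borel_measurable borel" "\<And>x. \<bar>G x\<bar> \<le> C"
  shows "integrable M (\<lambda>\<omega>. cond_exp_given M S X Y \<omega> * G (W \<omega>))"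
    and "(\<integral>\<omega>. cond_exp_given M S X Y \<omega> * G (W \<omega>) \<partial>M) = (\<integral>\<omega>. Y \<omega> * G (W \<omega>) \<partial>M)"
proof -
  have 1: "integrable M (\<lambda>\<omega>. G (W \<omega>) * Y \<omega>)"
    using integrable_bounded_mult[OF assms(1), of "\<lambda>\<omega>. G (W \<omega>)" C] G by (simp add: mult.commute)
  have 2: "(\<lambda>\<omega>. G (W \<omega>)) \<in> borel_measurable sigma_X"
    using G(1) by measurable
  note 3 = real_cond_exp_intg[OF 1 2 borel_measurable_integrable[OF assms(1)]]
  show "integrable M (\<lambda>\<omega>. cond_exp_given M S X Y \<omega> * G (W \<omega>))"
    "(\<integral>\<omega>. cond_exp_given M S X Y \<omega> * G (W \<omega>) \<partial>M) = (\<integral>\<omega>. Y \<omega> * G (W \<omega>) \<partial>M)"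
    using 3 by (simp_all add: cond_exp_given_def mult.commute)
qed

lemma integrable_defects: "integrable M variance_defect" "integrable M Dstar_drift"
  using cond_exp_mult(1)[OF integrable_D_Delta, of "\<lambda>_. 1" 1]
    cond_exp_mult(1)[OF integrable_Dstar_Delta, of "\<lambda>_. 1" 1]
  unfolding variance_defect_def[abs_def] Dstar_drift_def[abs_def] by auto

text \<open>
  By the regression property \<open>W\<close> is a conditional expectation of \<open>D / lam\<close> minus \<open>R\<close>.
\<close>
lemma integrable_W: "integrable M W"
proof -
  have "integrable M (cond_exp_given M S X D)"
    using cond_exp_mult(1)[OF integrable_D, of "\<lambda>_. 1" 1] by simp
  hence "integrable M (\<lambda>\<omega>. cond_exp_given M S X D \<omega> / lam - R \<omega>)"
    using integrable_R by simp
  moreover have "AE \<omega> in M. cond_exp_given M S X D \<omega> / lam - R \<omega> = W \<omega>"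
    using linearity by eventually_elim (use lam_pos in simp)
  ultimately show ?thesis
    using integrable_R by (subst integrable_cong_AE[symmetric]) (auto intro: borel_measurable_integrable)
qed

lemma exchange:
  assumes [measurable]: "k \<in> borel_measurable (S \<Otimes>\<^sub>M S)"
  shows "(\<integral>\<omega>. k (X \<omega>, X' \<omega>) \<partial>M) = (\<integral>\<omega>. k (X' \<omega>, X \<omega>) \<partial>M :: real)"
proof -
  have "(\<integral>\<omega>. k (X \<omega>, X' \<omega>) \<partial>M)
    = integral\<^sup>L (distr M (S \<Otimes>\<^sub>M S) (\<lambda>\<omega>. (X \<omega>, X' \<omega>))) k"
    by (rule integral_distr[symmetric]) measurable
  also have "\<dots> = integral\<^sup>L (distr M (S \<Otimes>\<^sub>M S) (\<lambda>\<omega>. (X' \<omega>, X \<omega>))) k"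
    using exchangeable by (simp add: exchangeable_pair_def)
  also have "\<dots> = (\<integral>\<omega>. k (X' \<omega>, X \<omega>) \<partial>M)"
    by (rule integral_distr) measurable
  finally show ?thesis .
qed

lemma D_swap: "\<omega> \<in> space M \<Longrightarrow> \<Psi> (X' \<omega>, X \<omega>) = - D \<omega>"
  using antisymmetric[of "X' \<omega>" "X \<omega>"] measurable_space[OF X_measurable(1)]
    measurable_space[OF X_measurable(2)] by (simp add: D_eq)

lemma D_swap_expectation:
  assumes [measurable]: "f \<in> borel_measurable borel"
  shows "(\<integral>\<omega>. D \<omega> * f (W' \<omega>) \<partial>M) = - (\<integral>\<omega>. D \<omega> * f (W \<omega>) \<partial>M)"
proof -
  have "(\<integral>\<omega>. D \<omega> * f (W' \<omega>) \<partial>M) = (\<integral>\<omega>. \<Psi> (X' \<omega>, X \<omega>) * f (\<phi> (X \<omega>)) \<partial>M)"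
    using exchange[of "\<lambda>(x, y). \<Psi> (x, y) * f (\<phi> y)"] by (simp add: D_eq W'_eq)
  also have "\<dots> = (\<integral>\<omega>. - (D \<omega> * f (W \<omega>)) \<partial>M)"
    by (intro Bochner_Integration.integral_cong) (auto simp: D_swap W_eq)
  finally show ?thesis by simp
qed

lemma D_Delta_swap_expectation:
  assumes [measurable]: "g \<in> borel_measurable borel"
  shows "(\<integral>\<omega>. D \<omega> * \<Delta> \<omega> * g (W' \<omega>) \<partial>M) = (\<integral>\<omega>. D \<omega> * \<Delta> \<omega> * g (W \<omega>) \<partial>M)"
proof -
  have "(\<integral>\<omega>. D \<omega> * \<Delta> \<omega> * g (W' \<omega>) \<partial>M)
     = (\<integral>\<omega>. \<Psi> (X' \<omega>, X \<omega>) * (\<phi> (X' \<omega>) - \<phi> (X \<omega>)) * g (\<phi> (X \<omega>)) \<partial>M)"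
    using exchange[of "\<lambda>(x, y). \<Psi> (x, y) * (\<phi> x - \<phi> y) * g (\<phi> y)"]
    by (simp add: D_eq W'_eq W_eq Delta_eq)
  also have "\<dots> = (\<integral>\<omega>. D \<omega> * \<Delta> \<omega> * g (W \<omega>) \<partial>M)"
    by (intro Bochner_Integration.integral_cong) (auto simp: D_swap W_eq Delta_eq W'_eq algebra_simps)
  finally show ?thesis .
qed

lemma Dstar_Delta_swap_expectation:
  assumes [measurable]: "g \<in> borel_measurable borel"
  shows "(\<integral>\<omega>. Dstar \<omega> * \<Delta> \<omega> * g (W' \<omega>) \<partial>M) = - (\<integral>\<omega>. Dstar \<omega> * \<Delta> \<omega> * g (W \<omega>) \<partial>M)"
proof -
  have "(\<integral>\<omega>. Dstar \<omega> * \<Delta> \<omega> * g (W' \<omega>) \<partial>M)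
     = (\<integral>\<omega>. Dfun (X' \<omega>, X \<omega>) * (\<phi> (X' \<omega>) - \<phi> (X \<omega>)) * g (\<phi> (X \<omega>)) \<partial>M)"
    using exchange[of "\<lambda>(x, y). Dfun (x, y) * (\<phi> x - \<phi> y) * g (\<phi> y)"]
    by (simp add: Dstar_eq W'_eq W_eq Delta_eq)
  also have "\<dots> = (\<integral>\<omega>. - (Dstar \<omega> * \<Delta> \<omega> * g (W \<omega>)) \<partial>M)"
  proof (rule integral_cong_AE)
    show "AE \<omega> in M. Dfun (X' \<omega>, X \<omega>) * (\<phi> (X' \<omega>) - \<phi> (X \<omega>)) * g (\<phi> (X \<omega>))
        = - (Dstar \<omega> * \<Delta> \<omega> * g (W \<omega>))"
      using Dfun_symmetric
      by eventually_elim (simp add: Dstar_eq Delta_eq W_eq W'_eq algebra_simps)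
  qed (simp_all add: Dstar_eq Delta_eq W_eq W'_eq)
  finally show ?thesis by simp
qed

text \<open>
  Exchangeability gives \<open>E(D f(W')) = - E(D f(W))\<close>, \<open>E(D \<Delta> g(W')) = E(D \<Delta> g(W))\<close> and
  \<open>E(Dstar \<Delta> k(W')) = - E(Dstar \<Delta> k(W))\<close>. Hence, with \<open>g = g1 - g2\<close> and \<open>k = g1 + g2\<close>, the
  difference on the left is \<open>1 / (2 lam)\<close> times the expectation of \<open>D\<close> times a trapezoidal error, and
  \<open>subgradient_midpoint\<close> together with \<open>\<bar>D\<bar> \<le> Dstar\<close> bounds it by an increment of \<open>k\<close>.
  
  Boundedness matters: \<open>Dstar * \<Delta>\<close> is merely integrable, and its product with \<open>exp (t * W)\<close> need not be.
\<close>
lemma stein_identity: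
  fixes f F1 F2 g1 g2 :: "real \<Rightarrow> real"
  assumes sub: "subgradient F1 g1" "subgradient F2 g2"
    and f: "\<And>x. f x = F1 x - F2 x"
    and [measurable]: "f \<in> borel_measurable borel" "g1 \<in> borel_measurable borel"
      "g2 \<in> borel_measurable borel"
    and bd: "\<And>x. \<bar>f x\<bar> \<le> C" "\<And>x. \<bar>g1 x\<bar> \<le> C1" "\<And>x. \<bar>g2 x\<bar> \<le> C2"
  shows "\<bar>(\<integral>\<omega>. (W \<omega> + R \<omega>) * f (W \<omega>) \<partial>M) - (\<integral>\<omega>. (1 - variance_defect \<omega>) * (g1 (W \<omega>) - g2 (W \<omega>)) \<partial>M)\<bar>
    \<le> (\<integral>\<omega>. Dstar_drift \<omega> * (g1 (W \<omega>) + g2 (W \<omega>)) \<partial>M)"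
proof -
  define g where "g x = g1 x - g2 x" for x
  define k where "k x = g1 x + g2 x" for x
  have [measurable]: "g \<in> borel_measurable borel" "k \<in> borel_measurable borel"
    unfolding g_def[abs_def] k_def[abs_def] by measurable
  have gb: "\<bar>g x\<bar> \<le> C1 + C2" "\<bar>k x\<bar> \<le> C1 + C2" for x
    using bd(2,3)[of x] unfolding g_def k_def by linarith+
  have [measurable]: "W' \<in> borel_measurable M" unfolding W'_eq by measurable
  have I: "integrable M (\<lambda>\<omega>. D \<omega> * f (W \<omega>))" "integrable M (\<lambda>\<omega>. D \<omega> * f (W' \<omega>))"
    by (rule integrable_bounded_mult[OF integrable_D _ bd(1)], measurable)+
  have J: "integrable M (\<lambda>\<omega>. D \<omega> * \<Delta> \<omega> * g (W \<omega>))" "integrable M (\<lambda>\<omega>. D \<omega> * \<Delta> \<omega> * g (W' \<omega>))"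
    by (rule integrable_bounded_mult[OF integrable_D_Delta _ gb(1)], measurable)+
  have L: "integrable M (\<lambda>\<omega>. Dstar \<omega> * \<Delta> \<omega> * k (W \<omega>))"
    "integrable M (\<lambda>\<omega>. Dstar \<omega> * \<Delta> \<omega> * k (W' \<omega>))"
    by (rule integrable_bounded_mult[OF integrable_Dstar_Delta _ gb(2)], measurable)+
  let ?Z = "\<lambda>\<omega>. D \<omega> * f (W \<omega>) - D \<omega> * f (W' \<omega>)
     - (D \<omega> * \<Delta> \<omega> * g (W \<omega>) + D \<omega> * \<Delta> \<omega> * g (W' \<omega>)) / 2"
  let ?U = "\<lambda>\<omega>. (Dstar \<omega> * \<Delta> \<omega> * k (W \<omega>) - Dstar \<omega> * \<Delta> \<omega> * k (W' \<omega>)) / 2"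
  have "(\<integral>\<omega>. ?Z \<omega> \<partial>M) = 2 * (\<integral>\<omega>. D \<omega> * f (W \<omega>) \<partial>M) - (\<integral>\<omega>. D \<omega> * \<Delta> \<omega> * g (W \<omega>) \<partial>M)"
    using I J by (simp add: D_swap_expectation D_Delta_swap_expectation)
  also have "(\<integral>\<omega>. D \<omega> * f (W \<omega>) \<partial>M) = (\<integral>\<omega>. cond_exp_given M S X D \<omega> * f (W \<omega>) \<partial>M)"
    by (rule cond_exp_mult(2)[OF integrable_D _ bd(1), symmetric]) measurable
  also have "\<dots> = (\<integral>\<omega>. lam * ((W \<omega> + R \<omega>) * f (W \<omega>)) \<partial>M)"
    using linearity by (intro integral_cong_AE) (auto simp: R_eq)
  also have "\<dots> = lam * (\<integral>\<omega>. (W \<omega> + R \<omega>) * f (W \<omega>) \<partial>M)" by (rule integral_mult_right_zero)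
  also have "(\<integral>\<omega>. D \<omega> * \<Delta> \<omega> * g (W \<omega>) \<partial>M)
      = (\<integral>\<omega>. cond_exp_given M S X (\<lambda>\<omega>. D \<omega> * \<Delta> \<omega>) \<omega> * g (W \<omega>) \<partial>M)"
    by (rule cond_exp_mult(2)[OF integrable_D_Delta _ gb(1), symmetric]) measurable
  also have "\<dots> = (\<integral>\<omega>. 2 * lam * ((1 - variance_defect \<omega>) * g (W \<omega>)) \<partial>M)"
    using lam_pos by (intro Bochner_Integration.integral_cong) (auto simp: variance_defect_def)
  also have "\<dots> = 2 * lam * (\<integral>\<omega>. (1 - variance_defect \<omega>) * g (W \<omega>) \<partial>M)" by (rule integral_mult_right_zero)
  finally have Z: "(\<integral>\<omega>. ?Z \<omega> \<partial>M) = 2 * lam * ((\<integral>\<omega>. (W \<omega> + R \<omega>) * f (W \<omega>) \<partial>M)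
      - (\<integral>\<omega>. (1 - variance_defect \<omega>) * g (W \<omega>) \<partial>M))"
    by (simp only: right_diff_distrib mult.assoc)
  have "(\<integral>\<omega>. ?U \<omega> \<partial>M) = (\<integral>\<omega>. Dstar \<omega> * \<Delta> \<omega> * k (W \<omega>) \<partial>M)"
    using L by (simp add: Dstar_Delta_swap_expectation)
  also have "\<dots> = (\<integral>\<omega>. cond_exp_given M S X (\<lambda>\<omega>. Dstar \<omega> * \<Delta> \<omega>) \<omega> * k (W \<omega>) \<partial>M)"
    by (rule cond_exp_mult(2)[OF integrable_Dstar_Delta _ gb(2), symmetric]) measurable
  also have "\<dots> = (\<integral>\<omega>. 2 * lam * (Dstar_drift \<omega> * k (W \<omega>)) \<partial>M)"
    using lam_pos by (intro Bochner_Integration.integral_cong) (auto simp: Dstar_drift_def)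
  finally have U: "(\<integral>\<omega>. ?U \<omega> \<partial>M) = 2 * lam * (\<integral>\<omega>. Dstar_drift \<omega> * k (W \<omega>) \<partial>M)"
    by simp
  have "\<bar>\<integral>\<omega>. ?Z \<omega> \<partial>M\<bar> \<le> (\<integral>\<omega>. ?U \<omega> \<partial>M)"
  proof (rule order_trans[OF integral_abs_bound integral_mono_AE])
    show "integrable M (\<lambda>\<omega>. \<bar>?Z \<omega>\<bar>)" "integrable M ?U" using I J L by auto
    show "AE \<omega> in M. \<bar>?Z \<omega>\<bar> \<le> ?U \<omega>"
      using Dstar_ge
    proof eventually_elim
      fix \<omega> assume *: "\<bar>D \<omega>\<bar> \<le> Dstar \<omega>"
      let ?w = "W \<omega>" and ?v = "W' \<omega>"
      \<comment> \<open>trapezoidal errors of the two convex parts\<close>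
      let ?e1 = "F1 ?w - F1 ?v - (?w - ?v) * (g1 ?w + g1 ?v) / 2"
      let ?e2 = "F2 ?w - F2 ?v - (?w - ?v) * (g2 ?w + g2 ?v) / 2"
      let ?b = "(?w - ?v) * (g1 ?w - g1 ?v) / 2 + (?w - ?v) * (g2 ?w - g2 ?v) / 2"
      have e: "\<bar>?e1 - ?e2\<bar> \<le> ?b"
        using subgradient_midpoint[OF sub(1), of ?w ?v] subgradient_midpoint[OF sub(2), of ?w ?v]
        by linarith
      have "?Z \<omega> = D \<omega> * (?e1 - ?e2)"
        unfolding f g_def Delta_eq by (simp add: field_simps)
      hence "\<bar>?Z \<omega>\<bar> = \<bar>D \<omega>\<bar> * \<bar>?e1 - ?e2\<bar>" by (simp only: abs_mult)
      also have "\<dots> \<le> Dstar \<omega> * ?b" using e * by (intro mult_mono) auto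
      also have "\<dots> = ?U \<omega>" unfolding k_def Delta_eq by (simp add: field_simps)
      finally show "\<bar>?Z \<omega>\<bar> \<le> ?U \<omega>" .
    qed
  qed
  thus ?thesis
    unfolding Z U abs_mult using lam_pos by (simp add: g_def k_def)
qed

text \<open>
  The identity with the absolute values moved inside. Both \<open>\<bar>g1 - g2\<bar>\<close> and \<open>g1 + g2\<close> are bounded by
  \<open>g1 + g2\<close>, so that one estimate serves for both defects.
\<close>
lemma stein_discrepancy:
  fixes f F1 F2 g1 g2 :: "real \<Rightarrow> real"
  assumes sub: "subgradient F1 g1" "subgradient F2 g2"
    and f: "\<And>x. f x = F1 x - F2 x"
    and [measurable]: "f \<in> borel_measurable borel" "g1 \<in> borel_measurable borel"
      "g2 \<in> borel_measurable borel"
    and bd: "\<And>x. \<bar>f x\<bar> \<le> C" "\<And>x. \<bar>g1 x\<bar> \<le> C1" "\<And>x. \<bar>g2 x\<bar> \<le> C2"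
    and nonneg: "\<And>x. 0 \<le> g1 x" "\<And>x. 0 \<le> g2 x"
  shows "\<bar>(\<integral>\<omega>. W \<omega> * f (W \<omega>) - (g1 (W \<omega>) - g2 (W \<omega>)) \<partial>M)\<bar>
    \<le> (\<integral>\<omega>. \<bar>R \<omega>\<bar> * \<bar>f (W \<omega>)\<bar> \<partial>M) + (\<integral>\<omega>. \<bar>variance_defect \<omega>\<bar> * (g1 (W \<omega>) + g2 (W \<omega>)) \<partial>M)
      + (\<integral>\<omega>. \<bar>Dstar_drift \<omega>\<bar> * (g1 (W \<omega>) + g2 (W \<omega>)) \<partial>M)"
proof -
  have gb: "\<bar>g1 x - g2 x\<bar> \<le> C1 + C2" "\<bar>g1 x + g2 x\<bar> \<le> C1 + C2" for x
    using bd(2,3)[of x] by linarith+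
  note bm = integrable_bounded_mult
  have I: "integrable M (\<lambda>\<omega>. W \<omega> * f (W \<omega>))" "integrable M (\<lambda>\<omega>. R \<omega> * f (W \<omega>))"
    "integrable M (\<lambda>\<omega>. \<bar>R \<omega>\<bar> * \<bar>f (W \<omega>)\<bar>)"
    using bm[OF integrable_W, of "\<lambda>\<omega>. f (W \<omega>)" C] bm[OF integrable_R, of "\<lambda>\<omega>. f (W \<omega>)" C] 
      bm[OF integrable_abs[OF integrable_R], of "\<lambda>\<omega>. \<bar>f (W \<omega>)\<bar>" C] bd(1) by auto
  have G: "integrable M (\<lambda>\<omega>. g1 (W \<omega>) - g2 (W \<omega>))" 
    using gb(1) by (intro integrable_const_bound[where B = "C1 + C2"]) auto
  have J: "integrable M (\<lambda>\<omega>. variance_defect \<omega> * (g1 (W \<omega>) - g2 (W \<omega>)))"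
    "integrable M (\<lambda>\<omega>. \<bar>variance_defect \<omega>\<bar> * (g1 (W \<omega>) + g2 (W \<omega>)))"
    "integrable M (\<lambda>\<omega>. \<bar>Dstar_drift \<omega>\<bar> * (g1 (W \<omega>) + g2 (W \<omega>)))"
    "integrable M (\<lambda>\<omega>. Dstar_drift \<omega> * (g1 (W \<omega>) + g2 (W \<omega>)))"
    using gb by (auto intro!: bm[where C = "C1 + C2"] integrable_defects)
  have id: "\<bar>(\<integral>\<omega>. (W \<omega> + R \<omega>) * f (W \<omega>) \<partial>M) - (\<integral>\<omega>. (1 - variance_defect \<omega>) * (g1 (W \<omega>) - g2 (W \<omega>)) \<partial>M)\<bar>
    \<le> (\<integral>\<omega>. Dstar_drift \<omega> * (g1 (W \<omega>) + g2 (W \<omega>)) \<partial>M)"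
    by (rule stein_identity[OF sub f _ _ _ bd]) measurable
  have 1: "(\<integral>\<omega>. (W \<omega> + R \<omega>) * f (W \<omega>) \<partial>M)
     = (\<integral>\<omega>. W \<omega> * f (W \<omega>) \<partial>M) + (\<integral>\<omega>. R \<omega> * f (W \<omega>) \<partial>M)"
    using I by (simp add: distrib_right)
  have 2: "(\<integral>\<omega>. (1 - variance_defect \<omega>) * (g1 (W \<omega>) - g2 (W \<omega>)) \<partial>M)
     = (\<integral>\<omega>. g1 (W \<omega>) - g2 (W \<omega>) \<partial>M) - (\<integral>\<omega>. variance_defect \<omega> * (g1 (W \<omega>) - g2 (W \<omega>)) \<partial>M)"
    unfolding left_diff_distrib mult_1_left by (rule Bochner_Integration.integral_diff[OF G J(1)])
  have 3: "(\<integral>\<omega>. W \<omega> * f (W \<omega>) - (g1 (W \<omega>) - g2 (W \<omega>)) \<partial>M)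
     = (\<integral>\<omega>. W \<omega> * f (W \<omega>) \<partial>M) - (\<integral>\<omega>. g1 (W \<omega>) - g2 (W \<omega>) \<partial>M)"
    by (rule Bochner_Integration.integral_diff[OF I(1) G])
  have a: "\<bar>\<integral>\<omega>. R \<omega> * f (W \<omega>) \<partial>M\<bar> \<le> (\<integral>\<omega>. \<bar>R \<omega>\<bar> * \<bar>f (W \<omega>)\<bar> \<partial>M)"
    using integral_abs_bound[of M "\<lambda>\<omega>. R \<omega> * f (W \<omega>)"] by (simp add: abs_mult)
  have b: "\<bar>\<integral>\<omega>. variance_defect \<omega> * (g1 (W \<omega>) - g2 (W \<omega>)) \<partial>M\<bar>
      \<le> (\<integral>\<omega>. \<bar>variance_defect \<omega>\<bar> * (g1 (W \<omega>) + g2 (W \<omega>)) \<partial>M)"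
  proof (rule order_trans[OF integral_abs_bound integral_mono])
    fix \<omega>
    have "\<bar>g1 (W \<omega>) - g2 (W \<omega>)\<bar> \<le> g1 (W \<omega>) + g2 (W \<omega>)" 
      using nonneg[of "W \<omega>"] by linarith
    thus "\<bar>variance_defect \<omega> * (g1 (W \<omega>) - g2 (W \<omega>))\<bar> \<le> \<bar>variance_defect \<omega>\<bar> * (g1 (W \<omega>) + g2 (W \<omega>))"
      by (simp add: abs_mult mult_left_mono)
  qed (use J in auto)
  have c: "(\<integral>\<omega>. Dstar_drift \<omega> * (g1 (W \<omega>) + g2 (W \<omega>)) \<partial>M) \<le> (\<integral>\<omega>. \<bar>Dstar_drift \<omega>\<bar> * (g1 (W \<omega>) + g2 (W \<omega>)) \<partial>M)"
    using nonneg by (intro integral_mono J mult_right_mono add_nonneg_nonneg) auto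
  show ?thesis using id a b c unfolding 1 2 3 by linarith
qed

end

section \<open>A discrete Gronwall inequality\<close>

text \<open>
  On a grid of mesh \<open>T / n\<close> the hypothesis reads \<open>h t * (1 - x) \<le> h s\<close> with a small \<open>x\<close>, and
  \<open>1 - x \<ge> exp (- x - 2 * x\<^sup>2)\<close>. Multiplying over the grid, the exponents form a Riemann sum of
  \<open>t A + B\<close> plus an error of order \<open>1 / n\<close>.
\<close>
lemma discrete_gronwall:
  fixes h :: "real \<Rightarrow> real"
  assumes T: "0 \<le> T" and A: "0 \<le> A" and B: "0 \<le> B" and h0: "h 0 = 1"
    and pos: "\<And>t. 0 \<le> t \<Longrightarrow> t \<le> T \<Longrightarrow> 0 \<le> h t"
    and step: "\<And>s t. 0 \<le> s \<Longrightarrow> s \<le> t \<Longrightarrow> t \<le> T \<Longrightarrow> h t - h s \<le> (t - s) * ((t * A + B) * h t)"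
  shows "h T \<le> exp (A * T\<^sup>2 / 2 + B * T)"
proof (rule LIMSEQ_le_const)
  \<comment> \<open>the largest growth rate on the interval; it controls the second-order errors\<close>
  define c where "c = T * A + B"
  have c: "0 \<le> c" unfolding c_def using assms by simp
  let ?E = "\<lambda>n k :: real. A * T\<^sup>2 * (k * (k + 1) / (2 * n\<^sup>2)) + B * T * (k / n) + (T * c)\<^sup>2 * (2 * k / n\<^sup>2)"
  have lim: "(\<lambda>n. ?E (real n) (real n)) \<longlonglongrightarrow> A * T\<^sup>2 / 2 + B * T"
  proof -
    have 1: "(\<lambda>n. real n * (real n + 1) / (2 * (real n)\<^sup>2)) \<longlonglongrightarrow> 1 / 2"
      "(\<lambda>n. real n / real n) \<longlonglongrightarrow> 1" "(\<lambda>n. 2 * real n / (real n)\<^sup>2) \<longlonglongrightarrow> 0"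
      by real_asymp+
    have "(\<lambda>n. A * T\<^sup>2 * (real n * (real n + 1) / (2 * (real n)\<^sup>2)) + B * T * (real n / real n)
        + (T * c)\<^sup>2 * (2 * real n / (real n)\<^sup>2)) \<longlonglongrightarrow> A * T\<^sup>2 * (1 / 2) + B * T * 1 + (T * c)\<^sup>2 * 0"
      by (intro tendsto_intros 1)
    thus ?thesis by simp
  qed
  show "(\<lambda>n. exp (?E (real n) (real n))) \<longlonglongrightarrow> exp (A * T\<^sup>2 / 2 + B * T)"
    by (intro tendsto_exp lim)
  show "\<exists>N. \<forall>n\<ge>N. h T \<le> exp (?E (real n) (real n))"
  proof (intro exI allI impI)
    \<comment> \<open>such \<open>n\<close> make every step \<open>x\<close> at most \<open>1 / 2\<close>, as the logarithmic bound requires\<close>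
    fix n :: nat assume "n \<ge> Suc (nat \<lceil>2 * (T * c)\<rceil>)"
    hence n0: "0 < n" and n: "2 * (T * c) \<le> n" by linarith+
    have claim: "k \<le> n \<Longrightarrow> h (real k * T / n) \<le> exp (?E (real n) (real k))" for k
    proof (induction k)
      case 0
      thus ?case using h0 by simp
    next
      case (Suc k)
      define t where "t = real (Suc k) * T / n"
      define s where "s = real k * T / n"
      have ts: "t - s = T / n" using n0 by (simp add: t_def s_def field_simps)
      have s0: "0 \<le> s" using T by (simp add: s_def)
      have "real (Suc k) * T \<le> real n * T"
        using Suc.prems T by (intro mult_right_mono) auto
      hence tT: "t \<le> T" using n0 by (simp add: t_def pos_divide_le_eq mult.commute)
      have st: "s \<le> t" using ts T by (smt (verit) divide_nonneg_nonneg of_nat_0_le_iff)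
      define x where "x = (t - s) * (t * A + B)"
      have x0: "0 \<le> x" unfolding x_def using s0 st A B by simp
      have "t * A + B \<le> c" unfolding c_def using tT A by (simp add: mult_right_mono)
      hence xc: "x \<le> T * c / n"
        unfolding x_def ts using T n0 by (simp add: divide_right_mono mult_left_mono)
      also have "\<dots> \<le> 1 / 2" using n n0 by (simp add: field_simps)
      finally have x2: "x \<le> 1 / 2" .
      have "exp (- x - 2 * x\<^sup>2) \<le> 1 - x"
        using ln_one_minus_pos_lower_bound[OF x0 x2] x2 by (simp add: ln_ge_iff)
      hence "h t * exp (- x - 2 * x\<^sup>2) \<le> h t * (1 - x)"
        using pos[of t] s0 st tT by (intro mult_left_mono) auto
      also have "\<dots> \<le> h s" using step[OF s0 st tT] unfolding x_def by (simp add: algebra_simps)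
      also have "\<dots> \<le> exp (?E (real n) (real k))" using Suc unfolding s_def by simp
      finally have "h t \<le> exp (?E (real n) (real k)) * exp (x + 2 * x\<^sup>2)"
        by (simp add: exp_diff exp_add exp_minus field_simps)
      also have "\<dots> = exp (?E (real n) (real k) + (x + 2 * x\<^sup>2))" by (simp only: exp_add)
      also have "\<dots> \<le> exp (?E (real n) (real k) + (x + 2 * (T * c / n)\<^sup>2))"
        using x0 xc by (simp add: power_mono)
      also have "?E (real n) (real k) + (x + 2 * (T * c / n)\<^sup>2) = ?E (real n) (real (Suc k))"
      proof -
        have "x = T / n * (real (Suc k) * T / n * A + B)" by (simp only: x_def ts) (simp only: t_def)
        thus ?thesis
          using n0 by (simp add: divide_simps power2_eq_square) (simp add: algebra_simps)
      qed
      finally show ?case unfolding t_def .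
    qed
    thus "h T \<le> exp (?E (real n) (real n))" using claim[of n] n0 by simp
  qed
qed

section \<open>Moment generating function and moderate deviations\<close>

text \<open>
  The conditions on exponentially tilted expectations, with the conditional expectations named as
  \<open>variance_defect\<close> and \<open>Dstar_drift\<close>.
\<close>
locale tilted_stein_pair = exchangeable_stein_pair +
  fixes \<tau> :: real and \<delta>1 \<delta>2 \<delta>3 :: "real \<Rightarrow> real"
  assumes tau_pos: "0 < \<tau>"
    and mono_delta: "mono_on {0..\<tau>} \<delta>1" "mono_on {0..\<tau>} \<delta>2" "mono_on {0..\<tau>} \<delta>3"
    and D_tilt: "\<And>t. 0 \<le> t \<Longrightarrow> t \<le> \<tau> \<Longrightarrow>
      integrable M (\<lambda>\<omega>. (1 + \<bar>D \<omega>\<bar>) * exp (t * W \<omega>))"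
    and variance_defect_tilt: "\<And>t. 0 \<le> t \<Longrightarrow> t \<le> \<tau> \<Longrightarrow> expectation_le M
        (\<lambda>\<omega>. \<bar>variance_defect \<omega>\<bar> * exp (t * W \<omega>)) (\<delta>1 t * (\<integral>\<omega>. exp (t * W \<omega>) \<partial>M))"
    and Dstar_drift_tilt: "\<And>t. 0 \<le> t \<Longrightarrow> t \<le> \<tau> \<Longrightarrow> expectation_le M
        (\<lambda>\<omega>. \<bar>Dstar_drift \<omega>\<bar> * exp (t * W \<omega>)) (\<delta>2 t * (\<integral>\<omega>. exp (t * W \<omega>) \<partial>M))"
    and R_tilt: "\<And>t. 0 \<le> t \<Longrightarrow> t \<le> \<tau> \<Longrightarrow> expectation_le M
        (\<lambda>\<omega>. \<bar>R \<omega>\<bar> * exp (t * W \<omega>)) (\<delta>3 t * (\<integral>\<omega>. exp (t * W \<omega>) \<partial>M))"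
begin

definition mgf :: "real \<Rightarrow> real" where
  "mgf t = (\<integral>\<omega>. exp (t * W \<omega>) \<partial>M)"

lemma R_measurable [measurable]: "R \<in> borel_measurable M"
  unfolding R_eq by measurable

lemma D_measurable [measurable]: "D \<in> borel_measurable M"
  unfolding D_eq by measurable

lemma integrable_exp:
  assumes "0 \<le> t" "t \<le> \<tau>"
  shows "integrable M (\<lambda>\<omega>. exp (t * W \<omega>))"
  by (rule Bochner_Integration.integrable_bound[OF D_tilt[OF assms]]) (auto intro!: AE_I2)

lemma integrable_D_exp:
  assumes "0 \<le> t" "t \<le> \<tau>"
  shows "integrable M (\<lambda>\<omega>. exp (t * W \<omega>) * D \<omega>)"
  by (rule Bochner_Integration.integrable_bound[OF D_tilt[OF assms]])
     (auto intro!: AE_I2 simp: abs_mult)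

lemma mgf_pos:
  assumes "0 \<le> t" "t \<le> \<tau>"
  shows "0 < mgf t"
proof -
  have "mgf t \<ge> 0" unfolding mgf_def by simp
  moreover have "mgf t \<noteq> 0"
    unfolding mgf_def
    by (subst integral_nonneg_eq_0_iff_AE[OF integrable_exp[OF assms]]) (auto simp: AE_False prob_space)
  ultimately show ?thesis by simp
qed

lemma mgf_0: "mgf 0 = 1"
  unfolding mgf_def by (simp add: prob_space)

text \<open>
  The rates are not assumed nonnegative, but they bound expectations of nonnegative variables.
\<close>
lemma tilt_rate_nonneg:
  assumes "expectation_le M (\<lambda>\<omega>. \<bar>Y \<omega>\<bar> * exp (t * W \<omega>)) (\<delta> t * (\<integral>\<omega>. exp (t * W \<omega>) \<partial>M))"
    and "0 \<le> t" "t \<le> \<tau>"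
  shows "0 \<le> \<delta> t"
proof -
  have "0 \<le> (\<integral>\<omega>. \<bar>Y \<omega>\<bar> * exp (t * W \<omega>) \<partial>M)" by simp
  also have "\<dots> \<le> \<delta> t * mgf t" using assms(1) by (simp add: expectation_le_def mgf_def)
  finally show ?thesis using mgf_pos[OF assms(2,3)] by (simp add: zero_le_mult_iff)
qed

lemma delta_nonneg:
  assumes "0 \<le> t" "t \<le> \<tau>"
  shows "0 \<le> \<delta>1 t" "0 \<le> \<delta>2 t" "0 \<le> \<delta>3 t"
  using tilt_rate_nonneg[where \<delta> = \<delta>1, OF variance_defect_tilt[OF assms] assms]
    tilt_rate_nonneg[where \<delta> = \<delta>2, OF Dstar_drift_tilt[OF assms] assms]
    tilt_rate_nonneg[where \<delta> = \<delta>3, OF R_tilt[OF assms] assms] by auto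

lemma delta_mono:
  assumes "0 \<le> s" "s \<le> t" "t \<le> \<tau>"
  shows "\<delta>1 s \<le> \<delta>1 t" "\<delta>2 s \<le> \<delta>2 t" "\<delta>3 s \<le> \<delta>3 t"
  using mono_delta assms by (auto dest!: mono_onD[where r = s and s = t])

text \<open>
  Again through the regression property: \<open>D exp(t W)\<close> and \<open>R exp(t W)\<close> are integrable.
\<close>
lemma integrable_W_exp:
  assumes "0 \<le> t" "t \<le> \<tau>"
  shows "integrable M (\<lambda>\<omega>. W \<omega> * exp (t * W \<omega>))"
proof -
  have "integrable M (\<lambda>\<omega>. exp (t * W \<omega>) * cond_exp_given M S X D \<omega>)"
    unfolding cond_exp_given_def by (rule real_cond_exp_intg(1)[OF integrable_D_exp[OF assms]]) measurable
  moreover have "integrable M (\<lambda>\<omega>. R \<omega> * exp (t * W \<omega>))"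
    by (rule Bochner_Integration.integrable_bound[of M "\<lambda>\<omega>. \<bar>R \<omega>\<bar> * exp (t * W \<omega>)"])
       (use R_tilt[OF assms] in \<open>auto simp: expectation_le_def abs_mult\<close>)
  ultimately have "integrable M (\<lambda>\<omega>. exp (t * W \<omega>) * cond_exp_given M S X D \<omega> / lam
      - R \<omega> * exp (t * W \<omega>))"
    by simp
  moreover have "AE \<omega> in M. exp (t * W \<omega>) * cond_exp_given M S X D \<omega> / lam
      - R \<omega> * exp (t * W \<omega>) = W \<omega> * exp (t * W \<omega>)"
    using linearity by eventually_elim (use lam_pos in \<open>simp add: field_simps\<close>)
  ultimately show ?thesis
    by (subst integrable_cong_AE[symmetric]) auto
qed

text \<open>
  Stein's identity for \<open>exp (t * W)\<close>, obtained from the bounded functions \<open>exp (t * min w n)\<close> as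
  \<open>n\<close> tends to infinity. Their derivative \<open>t * exp (t * w) * 1{w \<le> n}\<close> drops to zero at \<open>n\<close>, so it
  is split as \<open>t * exp (t * min w n)\<close> minus a multiple of the indicator of \<open>w > n\<close>. The second part
  disappears in the limit, so it costs nothing in the constant.
\<close>
lemma tilted_mean:
  assumes t: "0 \<le> t" "t \<le> \<tau>"
  shows "\<bar>(\<integral>\<omega>. W \<omega> * exp (t * W \<omega>) \<partial>M) - t * mgf t\<bar> \<le> (t * (\<delta>1 t + \<delta>2 t) + \<delta>3 t) * mgf t"
proof -
  define f where "f n w = exp (t * min w (real n))" for n w
  define g2 where "g2 n w = t * exp (t * real n) * indicator {real n<..} w" for n w
  have [measurable]: "f n \<in> borel_measurable borel" "g2 n \<in> borel_measurable borel" for n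
    unfolding f_def[abs_def] g2_def[abs_def] by measurable
  have f_nonneg: "0 \<le> f n w" and f_le: "f n w \<le> exp (t * w)" and f_le': "f n w \<le> exp (t * real n)" for n w
    unfolding f_def using t by (auto intro: mult_left_mono)
  have g2_nonneg: "0 \<le> g2 n w" and g2_le: "g2 n w \<le> t * exp (t * w)"
    and g2_le': "g2 n w \<le> t * exp (t * real n)" for n w
    unfolding g2_def using t by (auto simp: indicator_def intro!: mult_left_mono)
  have ev: "\<forall>\<^sub>F n in sequentially. f n w = exp (t * w) \<and> g2 n w = 0" for w
    using eventually_ge_at_top[of "nat \<lceil>w\<rceil>"]
  proof eventually_elim
    fix n assume "nat \<lceil>w\<rceil> \<le> n"
    hence "w \<le> real n" by linarith
    thus "f n w = exp (t * w) \<and> g2 n w = 0" by (simp add: f_def g2_def)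
  qed
  have flim: "(\<lambda>n. f n w) \<longlonglongrightarrow> exp (t * w)" and g2lim: "(\<lambda>n. g2 n w) \<longlonglongrightarrow> 0" for w
    using ev[of w] by (auto intro!: tendsto_eventually elim: eventually_mono)
  have ineq: "\<bar>(\<integral>\<omega>. W \<omega> * f n (W \<omega>) - (t * f n (W \<omega>) - g2 n (W \<omega>)) \<partial>M)\<bar>
    \<le> (\<integral>\<omega>. \<bar>R \<omega>\<bar> * \<bar>f n (W \<omega>)\<bar> \<partial>M) + (\<integral>\<omega>. \<bar>variance_defect \<omega>\<bar> * (t * f n (W \<omega>) + g2 n (W \<omega>)) \<partial>M)
      + (\<integral>\<omega>. \<bar>Dstar_drift \<omega>\<bar> * (t * f n (W \<omega>) + g2 n (W \<omega>)) \<partial>M)" for n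
  proof (rule stein_discrepancy)
    show "subgradient (\<lambda>w. f n w + t * exp (t * real n) * max (w - real n) 0) (\<lambda>w. t * f n w)"
      unfolding f_def by (rule subgradient_capped_exp[OF t(1)])
    show "subgradient (\<lambda>w. t * exp (t * real n) * max (w - real n) 0) (g2 n)"
      unfolding g2_def by (rule subgradient_hinge) (use t in simp)
    show "\<bar>f n x\<bar> \<le> exp (t * real n)" for x using f_le' f_nonneg by simp
    show "\<bar>t * f n x\<bar> \<le> t * exp (t * real n)" for x
      using f_le' f_nonneg t by (simp add: abs_mult mult_left_mono)
    show "\<bar>g2 n x\<bar> \<le> t * exp (t * real n)" for x using g2_le' g2_nonneg by simp
  qed (use t f_nonneg g2_nonneg in simp_all)
  have K_lim: "(\<lambda>n. \<integral>\<omega>. \<bar>K \<omega>\<bar> * (t * f n (W \<omega>) + g2 n (W \<omega>)) \<partial>M)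
      \<longlonglongrightarrow> (\<integral>\<omega>. \<bar>K \<omega>\<bar> * (t * exp (t * W \<omega>) + 0) \<partial>M)"
    if I: "integrable M (\<lambda>\<omega>. \<bar>K \<omega>\<bar> * exp (t * W \<omega>))" and [measurable]: "K \<in> borel_measurable M" for K
  proof (rule integral_dominated_convergence)
    show "integrable M (\<lambda>\<omega>. 2 * t * (\<bar>K \<omega>\<bar> * exp (t * W \<omega>)))" using I by simp
    show "AE \<omega> in M. (\<lambda>n. \<bar>K \<omega>\<bar> * (t * f n (W \<omega>) + g2 n (W \<omega>)))
        \<longlonglongrightarrow> \<bar>K \<omega>\<bar> * (t * exp (t * W \<omega>) + 0)"
      by (intro AE_I2 tendsto_intros flim g2lim)
    show "AE \<omega> in M. norm (\<bar>K \<omega>\<bar> * (t * f n (W \<omega>) + g2 n (W \<omega>))) \<le> 2 * t * (\<bar>K \<omega>\<bar> * exp (t * W \<omega>))" for n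
    proof (rule AE_I2)
      fix \<omega>
      have "t * f n (W \<omega>) \<le> t * exp (t * W \<omega>)" using f_le t by (intro mult_left_mono) auto
      hence "t * f n (W \<omega>) + g2 n (W \<omega>) \<le> 2 * t * exp (t * W \<omega>)"
        using g2_le[of n "W \<omega>"] by simp
      moreover have "0 \<le> t * f n (W \<omega>) + g2 n (W \<omega>)" using t f_nonneg g2_nonneg by simp
      ultimately show "norm (\<bar>K \<omega>\<bar> * (t * f n (W \<omega>) + g2 n (W \<omega>))) \<le> 2 * t * (\<bar>K \<omega>\<bar> * exp (t * W \<omega>))"
        using mult_left_mono[of "t * f n (W \<omega>) + g2 n (W \<omega>)" "2 * t * exp (t * W \<omega>)" "\<bar>K \<omega>\<bar>"]
        by (simp add: abs_mult mult_ac)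
    qed
  qed (measurable)
  have R_int: "(\<integral>\<omega>. \<bar>R \<omega>\<bar> * \<bar>f n (W \<omega>)\<bar> \<partial>M) \<le> \<delta>3 t * mgf t" for n
  proof -
    have "(\<integral>\<omega>. \<bar>R \<omega>\<bar> * \<bar>f n (W \<omega>)\<bar> \<partial>M) \<le> (\<integral>\<omega>. \<bar>R \<omega>\<bar> * exp (t * W \<omega>) \<partial>M)"
      by (rule integral_mono') (use R_tilt[OF t] f_le f_nonneg in \<open>auto simp: expectation_le_def mult_left_mono\<close>)
    thus ?thesis using R_tilt[OF t] by (simp add: expectation_le_def mgf_def)
  qed
  have lhs: "(\<lambda>n. \<integral>\<omega>. W \<omega> * f n (W \<omega>) - (t * f n (W \<omega>) - g2 n (W \<omega>)) \<partial>M)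
     \<longlonglongrightarrow> (\<integral>\<omega>. W \<omega> * exp (t * W \<omega>) - (t * exp (t * W \<omega>) - 0) \<partial>M)"
  proof (rule integral_dominated_convergence)
    show "integrable M (\<lambda>\<omega>. \<bar>W \<omega> * exp (t * W \<omega>)\<bar> + 2 * t * exp (t * W \<omega>))"
      using integrable_W_exp[OF t] integrable_exp[OF t] by simp
    show "AE \<omega> in M. (\<lambda>n. W \<omega> * f n (W \<omega>) - (t * f n (W \<omega>) - g2 n (W \<omega>)))
        \<longlonglongrightarrow> W \<omega> * exp (t * W \<omega>) - (t * exp (t * W \<omega>) - 0)"
      by (intro AE_I2 tendsto_intros flim g2lim)
    show "AE \<omega> in M. norm (W \<omega> * f n (W \<omega>) - (t * f n (W \<omega>) - g2 n (W \<omega>)))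
         \<le> \<bar>W \<omega> * exp (t * W \<omega>)\<bar> + 2 * t * exp (t * W \<omega>)" for n
    proof (rule AE_I2)
      fix \<omega>
      have "t * f n (W \<omega>) \<le> t * exp (t * W \<omega>)" using f_le t by (intro mult_left_mono) auto
      moreover have "\<bar>W \<omega> * f n (W \<omega>)\<bar> \<le> \<bar>W \<omega> * exp (t * W \<omega>)\<bar>"
        using f_le f_nonneg by (simp add: abs_mult mult_left_mono)
      moreover have "0 \<le> t * f n (W \<omega>)" using t f_nonneg by simp
      ultimately show "norm (W \<omega> * f n (W \<omega>) - (t * f n (W \<omega>) - g2 n (W \<omega>)))
         \<le> \<bar>W \<omega> * exp (t * W \<omega>)\<bar> + 2 * t * exp (t * W \<omega>)"
        using g2_le[of n "W \<omega>"] g2_nonneg[of n "W \<omega>"] unfolding real_norm_def by linarith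
    qed
  qed measurable
  have K1I: "integrable M (\<lambda>\<omega>. \<bar>variance_defect \<omega>\<bar> * exp (t * W \<omega>))" 
      "(\<integral>\<omega>. \<bar>variance_defect \<omega>\<bar> * exp (t * W \<omega>) \<partial>M) \<le> \<delta>1 t * mgf t"
    and K2I: "integrable M (\<lambda>\<omega>. \<bar>Dstar_drift \<omega>\<bar> * exp (t * W \<omega>))"
      "(\<integral>\<omega>. \<bar>Dstar_drift \<omega>\<bar> * exp (t * W \<omega>) \<partial>M) \<le> \<delta>2 t * mgf t"
    using variance_defect_tilt[OF t] Dstar_drift_tilt[OF t] by (auto simp: expectation_le_def mgf_def)
  have "\<bar>\<integral>\<omega>. W \<omega> * exp (t * W \<omega>) - (t * exp (t * W \<omega>) - 0) \<partial>M\<bar>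
     \<le> \<delta>3 t * mgf t + (\<integral>\<omega>. \<bar>variance_defect \<omega>\<bar> * (t * exp (t * W \<omega>) + 0) \<partial>M)
        + (\<integral>\<omega>. \<bar>Dstar_drift \<omega>\<bar> * (t * exp (t * W \<omega>) + 0) \<partial>M)"
  proof (rule LIMSEQ_le[OF tendsto_rabs[OF lhs]])
    show "(\<lambda>n. \<delta>3 t * mgf t + (\<integral>\<omega>. \<bar>variance_defect \<omega>\<bar> * (t * f n (W \<omega>) + g2 n (W \<omega>)) \<partial>M)
      + (\<integral>\<omega>. \<bar>Dstar_drift \<omega>\<bar> * (t * f n (W \<omega>) + g2 n (W \<omega>)) \<partial>M)) \<longlonglongrightarrow>
        \<delta>3 t * mgf t + (\<integral>\<omega>. \<bar>variance_defect \<omega>\<bar> * (t * exp (t * W \<omega>) + 0) \<partial>M)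
        + (\<integral>\<omega>. \<bar>Dstar_drift \<omega>\<bar> * (t * exp (t * W \<omega>) + 0) \<partial>M)"
      by (intro tendsto_intros K_lim K1I K2I defects_measurable)
  qed (use ineq R_int in \<open>intro exI[of _ 0] allI impI, smt (verit)\<close>)
  also have "(\<integral>\<omega>. W \<omega> * exp (t * W \<omega>) - (t * exp (t * W \<omega>) - 0) \<partial>M)
     = (\<integral>\<omega>. W \<omega> * exp (t * W \<omega>) \<partial>M) - t * mgf t"
    using integrable_W_exp[OF t] integrable_exp[OF t] by (simp add: mgf_def)
  also have "(\<integral>\<omega>. \<bar>variance_defect \<omega>\<bar> * (t * exp (t * W \<omega>) + 0) \<partial>M) = t * (\<integral>\<omega>. \<bar>variance_defect \<omega>\<bar> * exp (t * W \<omega>) \<partial>M)"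
    by (simp add: mult.left_commute)
  also have "\<dots> \<le> t * (\<delta>1 t * mgf t)" using K1I t by (intro mult_left_mono)
  also have "(\<integral>\<omega>. \<bar>Dstar_drift \<omega>\<bar> * (t * exp (t * W \<omega>) + 0) \<partial>M) = t * (\<integral>\<omega>. \<bar>Dstar_drift \<omega>\<bar> * exp (t * W \<omega>) \<partial>M)"
    by (simp add: mult.left_commute)
  also have "\<dots> \<le> t * (\<delta>2 t * mgf t)" using K2I t by (intro mult_left_mono)
  finally show ?thesis by (simp add: algebra_simps)
qed

text \<open>
  Convexity of \<open>t \<mapsto> exp (t * w)\<close> replaces differentiation under the integral sign.
\<close>
lemma mgf_diff_le:
  assumes "0 \<le> s" "s \<le> t" "t \<le> \<tau>"
  shows "mgf t - mgf s \<le> (t - s) * (\<integral>\<omega>. W \<omega> * exp (t * W \<omega>) \<partial>M)"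
proof -
  have "mgf t - mgf s = (\<integral>\<omega>. exp (t * W \<omega>) - exp (s * W \<omega>) \<partial>M)"
    using integrable_exp[of t] integrable_exp[of s] assms by (simp add: mgf_def)
  also have "\<dots> \<le> (\<integral>\<omega>. (t - s) * (W \<omega> * exp (t * W \<omega>)) \<partial>M)"
  proof (rule integral_mono)
    show "exp (t * W \<omega>) - exp (s * W \<omega>) \<le> (t - s) * (W \<omega> * exp (t * W \<omega>))" for \<omega>
      using exp_tangent[of "W \<omega>" t s] by (simp add: algebra_simps)
  qed (use integrable_exp[of t] integrable_exp[of s] integrable_W_exp[of t] assms in auto)
  finally show ?thesis by simp
qed

lemma mgf_le:
  assumes t: "0 \<le> t" "t \<le> \<tau>"
  shows "mgf t \<le> exp (t\<^sup>2 / 2 + (t\<^sup>2 / 2 * (\<delta>1 t + \<delta>2 t) + t * \<delta>3 t))"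
proof -
  have "mgf t \<le> exp ((1 + \<delta>1 t + \<delta>2 t) * t\<^sup>2 / 2 + \<delta>3 t * t)"
  proof (rule discrete_gronwall)
    fix s u assume su: "0 \<le> s" "s \<le> u" "u \<le> t"
    hence u: "0 \<le> u" "u \<le> \<tau>" using t by auto
    have "(\<integral>\<omega>. W \<omega> * exp (u * W \<omega>) \<partial>M) \<le> (u * (1 + \<delta>1 u + \<delta>2 u) + \<delta>3 u) * mgf u"
      using tilted_mean[OF u] by (simp add: algebra_simps)
    also have "\<dots> \<le> (u * (1 + \<delta>1 t + \<delta>2 t) + \<delta>3 t) * mgf u"
      using delta_mono[OF u(1) su(3) t(2)] mgf_pos[OF u] u
      by (intro mult_right_mono add_mono mult_left_mono) auto
    finally have "(u - s) * (\<integral>\<omega>. W \<omega> * exp (u * W \<omega>) \<partial>M)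
      \<le> (u - s) * ((u * (1 + \<delta>1 t + \<delta>2 t) + \<delta>3 t) * mgf u)"
      using su by (intro mult_left_mono) auto
    thus "mgf u - mgf s \<le> (u - s) * ((u * (1 + \<delta>1 t + \<delta>2 t) + \<delta>3 t) * mgf u)"
      using mgf_diff_le[OF su(1,2) u(2)] by simp
  qed (use t delta_nonneg[OF t] mgf_0 mgf_pos in \<open>auto intro!: less_imp_le\<close>)
  thus ?thesis by (simp add: algebra_simps add_divide_distrib)
qed

text \<open>
  For \<open>t < z\<close> some \<open>s > t\<close> satisfies the defining inequality of \<open>tau0\<close>, and its left side is
  nondecreasing. The supremum itself may violate it, so \<open>t = z\<close> is reached by
  letting \<open>s\<close> increase to \<open>z\<close> in \<open>mgf_diff_le\<close>.
\<close>
lemma mgf_le_gauss: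
  assumes theta: "0 < \<theta>" and z: "0 \<le> z" "z \<le> tau0 \<tau> \<delta>1 \<delta>2 \<delta>3 \<theta>"
  shows "z \<le> \<tau>" and "0 \<le> t \<Longrightarrow> t \<le> z \<Longrightarrow> mgf t \<le> exp (\<theta> + t\<^sup>2 / 2)"
proof -
  define T where "T = {t. 0 \<le> t \<and> t \<le> \<tau> \<and> t\<^sup>2 / 2 * (\<delta>1 t + \<delta>2 t) + t * \<delta>3 t \<le> \<theta>}"
  have zT: "z \<le> Sup T" using z by (simp add: tau0_def T_def)
  have "0 \<in> T" using tau_pos theta by (simp add: T_def)
  hence ne: "T \<noteq> {}" by blast
  have bdd: "bdd_above T" by (rule bdd_aboveI[of _ \<tau>]) (simp add: T_def)
  have "Sup T \<le> \<tau>" by (rule cSup_least[OF ne]) (simp add: T_def)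
  thus z\<tau>: "z \<le> \<tau>" using zT by simp
  have less: "mgf t \<le> exp (\<theta> + t\<^sup>2 / 2)" if t: "0 \<le> t" "t < z" for t
  proof -
    have "t < Sup T" using t zT by simp
    then obtain s where s: "s \<in> T" "t < s" using less_cSup_iff[OF ne bdd] by blast
    have s\<tau>: "s \<le> \<tau>" and sle: "s\<^sup>2 / 2 * (\<delta>1 s + \<delta>2 s) + s * \<delta>3 s \<le> \<theta>" using s by (auto simp: T_def)
    have "t\<^sup>2 / 2 * (\<delta>1 t + \<delta>2 t) + t * \<delta>3 t \<le> s\<^sup>2 / 2 * (\<delta>1 s + \<delta>2 s) + s * \<delta>3 s"
      using t s s\<tau> delta_mono[of t s] delta_nonneg[of t]
      by (intro add_mono mult_mono divide_right_mono power_mono) auto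
    hence "exp (t\<^sup>2 / 2 + (t\<^sup>2 / 2 * (\<delta>1 t + \<delta>2 t) + t * \<delta>3 t)) \<le> exp (\<theta> + t\<^sup>2 / 2)"
      using sle by simp
    with mgf_le[of t] t s s\<tau> show ?thesis by (intro order_trans[OF mgf_le]) auto
  qed
  assume t: "0 \<le> t" "t \<le> z"
  show "mgf t \<le> exp (\<theta> + t\<^sup>2 / 2)"
  proof (cases "t < z")
    case True
    thus ?thesis using less t by simp
  next
    case False
    hence tz: "t = z" using t by simp
    show ?thesis
    proof (cases "z = 0")
      case True
      thus ?thesis using tz mgf_0 theta by simp
    next
      case False
      define C where "C = \<bar>\<integral>\<omega>. W \<omega> * exp (z * W \<omega>) \<partial>M\<bar>"
      have "mgf z \<le> exp (\<theta> + z\<^sup>2 / 2) + e" if e: "0 < e" for e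
      proof -
        \<comment> \<open>close enough to \<open>z\<close> that \<open>(z - s) * C \<le> e\<close>; the \<open>+ 1\<close> covers \<open>C = 0\<close>\<close>
        define s where "s = max 0 (z - e / (C + 1))"
        have C: "0 \<le> C" by (simp add: C_def)
        have s: "0 \<le> s" "s < z" using False z e C by (auto simp: s_def)
        have "(z - s) * (\<integral>\<omega>. W \<omega> * exp (z * W \<omega>) \<partial>M) \<le> (z - s) * C"
          using s by (intro mult_left_mono) (auto simp: C_def)
        also have "\<dots> \<le> e / (C + 1) * C" using C by (intro mult_right_mono) (auto simp: s_def)
        also have "\<dots> \<le> e" using C e by (simp add: field_simps)
        finally have "mgf z \<le> mgf s + e" using mgf_diff_le[of s z] s z\<tau> by simp
        also have "mgf s \<le> exp (\<theta> + s\<^sup>2 / 2)" by (rule less[OF s])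
        also have "\<dots> \<le> exp (\<theta> + z\<^sup>2 / 2)" using s by (simp add: power_mono)
        finally show ?thesis by simp
      qed
      thus ?thesis unfolding tz by (rule field_le_epsilon)
    qed
  qed
qed

lemma moderate_deviation:
  assumes theta: "0 < \<theta>" and z: "0 \<le> z" "z \<le> tau0 \<tau> \<delta>1 \<delta>2 \<delta>3 \<theta>"
  shows "\<bar>prob {\<omega> \<in> space M. W \<omega> > z} / (1 - Phi z) - 1\<bar>
    \<le> 20 * exp \<theta> * ((1 + z\<^sup>2) * (\<delta>1 z + \<delta>2 z) + (1 + z) * \<delta>3 z)"
proof -
  let ?q = "1 - Phi z" and ?g2 = "\<lambda>w. 1 * indicator {z<..} w :: real"
  have q: "0 < ?q" using Phi_less_1 by simp
  note z\<tau> = mgf_le_gauss(1)[OF assms] and mgf_z = mgf_le_gauss(2)[OF assms]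
  have tilt: "expectation_le M (\<lambda>\<omega>. \<bar>Y \<omega>\<bar> * exp (t * W \<omega>)) (\<delta> z * exp \<theta> * exp (t\<^sup>2 / 2))"
    if t: "0 \<le> t" "t \<le> z" and le: "\<delta> t \<le> \<delta> z" and nn: "0 \<le> \<delta> t"
      and Y: "expectation_le M (\<lambda>\<omega>. \<bar>Y \<omega>\<bar> * exp (t * W \<omega>)) (\<delta> t * (\<integral>\<omega>. exp (t * W \<omega>) \<partial>M))"
    for Y and \<delta> :: "real \<Rightarrow> real" and t
  proof -
    have "\<delta> t * mgf t \<le> \<delta> z * exp (\<theta> + t\<^sup>2 / 2)"
      using le nn mgf_z[OF t] mgf_pos[of t] t z\<tau> by (intro mult_mono) auto
    thus ?thesis using Y unfolding expectation_le_def mgf_def by (simp add: exp_add mult.assoc)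
  qed
  have dz: "0 \<le> \<delta>1 z" "0 \<le> \<delta>2 z" "0 \<le> \<delta>3 z" using delta_nonneg[of z] z z\<tau> by auto
  have "(\<integral>\<omega>. W \<omega> * stein_sol z (W \<omega>) - (stein_slope z (W \<omega>) - ?g2 (W \<omega>)) \<partial>M)
      = (\<integral>\<omega>. indicator {\<omega> \<in> space M. W \<omega> > z} \<omega> - ?q \<partial>M)"
    by (intro Bochner_Integration.integral_cong) (auto simp: stein_slope_def indicator_def)
  also have "\<dots> = prob {\<omega> \<in> space M. W \<omega> > z} - ?q"
    by (subst Bochner_Integration.integral_diff)
       (auto simp: prob_space emeasure_eq_measure intro!: integrable_real_indicator)
  finally have eq: "prob {\<omega> \<in> space M. W \<omega> > z} - ?q
     = (\<integral>\<omega>. W \<omega> * stein_sol z (W \<omega>) - (stein_slope z (W \<omega>) - ?g2 (W \<omega>)) \<partial>M)" ..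
  have "\<bar>prob {\<omega> \<in> space M. W \<omega> > z} - ?q\<bar>
    \<le> (\<integral>\<omega>. \<bar>R \<omega>\<bar> * \<bar>stein_sol z (W \<omega>)\<bar> \<partial>M) + (\<integral>\<omega>. \<bar>variance_defect \<omega>\<bar> * (stein_slope z (W \<omega>) + ?g2 (W \<omega>)) \<partial>M)
      + (\<integral>\<omega>. \<bar>Dstar_drift \<omega>\<bar> * (stein_slope z (W \<omega>) + ?g2 (W \<omega>)) \<partial>M)"
    unfolding eq
  proof (rule stein_discrepancy)
    show "subgradient (\<lambda>w. stein_sol z w + 1 * max (w - z) 0) (stein_slope z)"
      using subgradient_stein[of z] by simp
    show "subgradient (\<lambda>w. 1 * max (w - z) 0) ?g2" by (rule subgradient_hinge) simp
    show "\<bar>stein_sol z x\<bar> \<le> 3 * exp (z\<^sup>2 / 2)" for x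
      using stein_sol_le[OF z(1), of x] stein_sol_nonneg[of z x] by simp
    show "\<bar>stein_slope z x\<bar> \<le> 1" for x
      using stein_slope_le_1[of z x] stein_slope_nonneg[of z x] by simp
    show "\<bar>?g2 x\<bar> \<le> 1" for x by (simp add: indicator_def)
  qed (auto simp: stein_slope_nonneg)
  also have "\<dots> \<le> 20 * (1 + z) * (\<delta>3 z * exp \<theta>) * ?q + 20 * (1 + z\<^sup>2) * (\<delta>1 z * exp \<theta>) * ?q
      + 20 * (1 + z\<^sup>2) * (\<delta>2 z * exp \<theta>) * ?q"
    using z z\<tau> dz delta_mono delta_nonneg
    by (intro add_mono expectation_stein_sol_le expectation_stein_slope_le tilt
          variance_defect_tilt Dstar_drift_tilt R_tilt) auto
  also have "\<dots> = 20 * exp \<theta> * ((1 + z\<^sup>2) * (\<delta>1 z + \<delta>2 z) + (1 + z) * \<delta>3 z) * ?q"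
    by (simp add: algebra_simps)
  finally have "\<bar>prob {\<omega> \<in> space M. W \<omega> > z} - ?q\<bar> / ?q
      \<le> 20 * exp \<theta> * ((1 + z\<^sup>2) * (\<delta>1 z + \<delta>2 z) + (1 + z) * \<delta>3 z)"
    using q by (simp only: pos_divide_le_eq)
  moreover have "\<bar>prob {\<omega> \<in> space M. W \<omega> > z} - ?q\<bar> / ?q = \<bar>prob {\<omega> \<in> space M. W \<omega> > z} / ?q - 1\<bar>"
  proof -
    have "(p - v) / v = p / v - 1" if "0 < v" for p v :: real
      using that by (simp add: diff_divide_distrib)
    thus ?thesis using q by (simp only: abs_div_pos)
  qed
  ultimately show ?thesis by simp
qed

end

section \<open>The moderate deviation theorem\<close>

theorem theorem2p1:
  fixes M :: "'a measure" and S :: "'b measure"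
    and X X' :: "'a \<Rightarrow> 'b"
    and \<phi> r :: "'b \<Rightarrow> real"
    and \<Psi> Dfun :: "'b \<times> 'b \<Rightarrow> real"
    and W W' \<Delta> D R Dstar :: "'a \<Rightarrow> real"
    and lam \<tau> \<theta> z :: real
    and \<delta>1 \<delta>2 \<delta>3 :: "real \<Rightarrow> real"
  assumes "prob_space M"
    and "exchangeable_pair M S X X'"
    and "\<phi> \<in> borel_measurable S"
    and W_eq: "W = (\<lambda>\<omega>. \<phi> (X \<omega>))"
    and W'_eq: "W' = (\<lambda>\<omega>. \<phi> (X' \<omega>))"
    and Delta_eq: "\<Delta> = (\<lambda>\<omega>. W \<omega> - W' \<omega>)"
    and "\<Psi> \<in> borel_measurable (S \<Otimes>\<^sub>M S)"
    and antisymmetric: "\<And>x x'. x \<in> space S \<Longrightarrow> x' \<in> space S \<Longrightarrow> \<Psi> (x, x') = - \<Psi> (x', x)"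
    and D_eq: "D = (\<lambda>\<omega>. \<Psi> (X \<omega>, X' \<omega>))"
    and "integrable M D"
    and "lam > 0"
    and "r \<in> borel_measurable S"
    and R_eq: "R = (\<lambda>\<omega>. r (X \<omega>))"
    and "AE \<omega> in M. cond_exp_given M S X D \<omega> = lam * (W \<omega> + R \<omega>)"
    and "Dfun \<in> borel_measurable (S \<Otimes>\<^sub>M S)"
    and Dstar_eq: "Dstar = (\<lambda>\<omega>. Dfun (X \<omega>, X' \<omega>))"
    and "AE \<omega> in M. Dfun (X \<omega>, X' \<omega>) = Dfun (X' \<omega>, X \<omega>)"
    and "AE \<omega> in M. Dstar \<omega> \<ge> \<bar>D \<omega>\<bar>"
    and "integrable M (\<lambda>\<omega>. D \<omega> * \<Delta> \<omega>)"
    and "integrable M (\<lambda>\<omega>. Dstar \<omega> * \<Delta> \<omega>)"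
    and "\<tau> > 0"
    and "mono_on {0..\<tau>} \<delta>1" and "mono_on {0..\<tau>} \<delta>2" and "mono_on {0..\<tau>} \<delta>3"
    and i: "\<And>t. 0 \<le> t \<Longrightarrow> t \<le> \<tau> \<Longrightarrow>
      integrable M (\<lambda>\<omega>. (1 + \<bar>D \<omega>\<bar>) * exp (t * W \<omega>))"
    and ii: "\<And>t. 0 \<le> t \<Longrightarrow> t \<le> \<tau> \<Longrightarrow>
      expectation_le M
        (\<lambda>\<omega>. \<bar>1 - 1 / (2 * lam) * cond_exp_given M S X (\<lambda>\<omega>. D \<omega> * \<Delta> \<omega>) \<omega>\<bar> * exp (t * W \<omega>))
        (\<delta>1 t * (\<integral>\<omega>. exp (t * W \<omega>) \<partial>M))"
    and iii: "\<And>t. 0 \<le> t \<Longrightarrow> t \<le> \<tau> \<Longrightarrow>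
      expectation_le M
        (\<lambda>\<omega>. \<bar>1 / (2 * lam) * cond_exp_given M S X (\<lambda>\<omega>. Dstar \<omega> * \<Delta> \<omega>) \<omega>\<bar> * exp (t * W \<omega>))
        (\<delta>2 t * (\<integral>\<omega>. exp (t * W \<omega>) \<partial>M))"
    and iv: "\<And>t. 0 \<le> t \<Longrightarrow> t \<le> \<tau> \<Longrightarrow>
      expectation_le M (\<lambda>\<omega>. \<bar>R \<omega>\<bar> * exp (t * W \<omega>))
        (\<delta>3 t * (\<integral>\<omega>. exp (t * W \<omega>) \<partial>M))"
    and "\<theta> > 0"
    and "0 \<le> z" and "z \<le> tau0 \<tau> \<delta>1 \<delta>2 \<delta>3 \<theta>"
  shows "\<bar>measure M {\<omega> \<in> space M. W \<omega> > z} / (1 - Phi z) - 1\<bar>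
    \<le> 20 * exp \<theta> * ((1 + z\<^sup>2) * (\<delta>1 z + \<delta>2 z) + (1 + z) * \<delta>3 z)"
proof -
  interpret exchangeable_stein_pair M S X X' \<phi> r \<Psi> Dfun W W' \<Delta> D R Dstar lam
  proof (intro exchangeable_stein_pair.intro exchangeable_stein_pair_axioms.intro)
    \<comment> \<open>at \<open>t = 0\<close> the tilt is trivial\<close>
    have "integrable M (\<lambda>\<omega>. \<bar>R \<omega>\<bar>)"
      using iv[of 0] \<open>\<tau> > 0\<close> by (simp add: expectation_le_def)
    moreover have "R \<in> borel_measurable M"
      using assms(2,12) unfolding R_eq exchangeable_pair_def by (auto intro: measurable_compose)
    ultimately show "integrable M R" by (rule integrable_abs_cancel)
  qed (fact | rule antisymmetric; assumption)+
  interpret tilted_stein_pair M S X X' \<phi> r \<Psi> Dfun W W' \<Delta> D R Dstar lam \<tau> \<delta>1 \<delta>2 \<delta>3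
  proof
    fix t :: real assume "0 \<le> t" "t \<le> \<tau>"
    note t = this
    show "integrable M (\<lambda>\<omega>. (1 + \<bar>D \<omega>\<bar>) * exp (t * W \<omega>))" by (rule i[OF t])
    show "expectation_le M (\<lambda>\<omega>. \<bar>variance_defect \<omega>\<bar> * exp (t * W \<omega>)) (\<delta>1 t * (\<integral>\<omega>. exp (t * W \<omega>) \<partial>M))"
      unfolding variance_defect_def by (rule ii[OF t])
    show "expectation_le M (\<lambda>\<omega>. \<bar>Dstar_drift \<omega>\<bar> * exp (t * W \<omega>)) (\<delta>2 t * (\<integral>\<omega>. exp (t * W \<omega>) \<partial>M))"
      unfolding Dstar_drift_def by (rule iii[OF t])
    show "expectation_le M (\<lambda>\<omega>. \<bar>R \<omega>\<bar> * exp (t * W \<omega>)) (\<delta>3 t * (\<integral>\<omega>. exp (t * W \<omega>) \<partial>M))"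
      by (rule iv[OF t])
  qed fact+
  show ?thesis by (rule moderate_deviation) fact+
qed

end
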